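(* Let $P\subset\mathbb{R}^3$ be a $3$-dimensional convex polytope (with the origin in its interior). If all edge length perturbations of $P$ are realizable via a continuous, locally injective map, then $P$ is rigid.
   Context: Let $P$ have vertex set $V$, edge set $E$ and facet set $F$, and write $i\sim\sigma$ if vertex $i$ lies on facet $\sigma$. The realization space of the combinatorial type $\mathcal P=(V,E,F,\sim)$ of $P$ is the set $\mathrm{REAL}(\mathcal P)\subset\mathbb{R}^{3V}\oplus\mathbb{R}^{3F}$ of pairs $(\boldsymbol p,\boldsymbol a)$ of maps $\boldsymbol p:V\to\mathbb{R}^3$, $\boldsymbol a:F\to\mathbb{R}^3$ with $\langle p_i,a_\sigma\rangle=1$ whenever $i\sim\sigma$ and $\langle p_i,a_\sigma\rangle<1$ whenever $i\not\sim\sigma$. $P$ is identified with the element of $\mathrm{REAL}(\mathcal P)$ given by its vertices and suitably scaled outward facet normals. Two realizations are equivalent if the distances $\|p_i-p_j\|$ agree for all edges $ij\in E$, and congruent if they agree for all pairs $i,j\in V$. A motion of $P$ is a continuous map $[0,1]\to\mathrm{REAL}(\mathcal P)$, starting at $P$, all of whose values are equivalent to $P$; it is trivial if all its values are congruent to $P$. $P$ is rigid if all its motions are trivial. The edge length map is $\boldsymbol\ell:\mathrm{REAL}(\mathcal P)\to\mathbb{R}^E$, $\boldsymbol\ell(\boldsymbol p,\boldsymbol a)=\big(\tfrac12\|p_i-p_j\|^2\big)_{ij\in E}$. All edge length perturbations of $P$ are said to be realizable via a continuous, locally injective map if there is a continuous map $\psi:\mathbb{R}^E\to\mathrm{REAL}(\mathcal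 P)$ with $\psi(\boldsymbol\ell(P))=P$ that is injective on a neighborhood of $\boldsymbol\ell(P)$ and realizes the edge lengths there, i.e. $\boldsymbol\ell(\psi(x))=x$ for all $x\in\mathbb{R}^E$ sufficiently close to $\boldsymbol\ell(P)$. *)

theory Defs
  imports "HOL-Analysis.Analysis"
begin

text \<open>
  The edges of a combinatorial type are unordered pairs of vertices.
  A space of maps \<open>I \<rightarrow> X\<close> with \<open>I\<close> a finite set is rendered as \<open>I \<rightarrow>\<^sub>E UNIV\<close>, the functions
  with the fixed value \<^term>\<open>undefined\<close> outside \<open>I\<close>. As a subspace of the function type, which
  carries the product topology, it is homeomorphic to the product of \<open>card I\<close> copies of \<open>X\<close>.
\<close>

record ('v, 'f) combinatorial_type =
  Verts :: "'v set"
  Edges :: "'v set set"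
  Facets :: "'f set"
  incident :: "'v \<Rightarrow> 'f \<Rightarrow> bool"

type_synonym ('v, 'f) config = "('v \<Rightarrow> real^3) \<times> ('f \<Rightarrow> real^3)"

definition REAL :: "('v, 'f) combinatorial_type \<Rightarrow> ('v, 'f) config set" where
  "REAL C = {(p, a). p \<in> Verts C \<rightarrow>\<^sub>E UNIV \<and> a \<in> Facets C \<rightarrow>\<^sub>E UNIV \<and>
     (\<forall>i\<in>Verts C. \<forall>\<sigma>\<in>Facets C.
        (incident C i \<sigma> \<longrightarrow> p i \<bullet> a \<sigma> = 1) \<and> (\<not> incident C i \<sigma> \<longrightarrow> p i \<bullet> a \<sigma> < 1))}"

definition equivalent ::
  "('v, 'f) combinatorial_type \<Rightarrow> ('v, 'f) config \<Rightarrow> ('v, 'f) config \<Rightarrow> bool" where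
  "equivalent C x y \<longleftrightarrow>
     (\<forall>i j. {i, j} \<in> Edges C \<longrightarrow> norm (fst x i - fst x j) = norm (fst y i - fst y j))"

definition congruent_config ::
  "('v, 'f) combinatorial_type \<Rightarrow> ('v, 'f) config \<Rightarrow> ('v, 'f) config \<Rightarrow> bool" where
  "congruent_config C x y \<longleftrightarrow>
     (\<forall>i\<in>Verts C. \<forall>j\<in>Verts C. norm (fst x i - fst x j) = norm (fst y i - fst y j))"

definition is_motion ::
  "('v, 'f) combinatorial_type \<Rightarrow> ('v, 'f) config \<Rightarrow> (real \<Rightarrow> ('v, 'f) config) \<Rightarrow> bool" where
  "is_motion C x \<gamma> \<longleftrightarrow> continuous_on {0..1} \<gamma> \<and> \<gamma> ` {0..1} \<subseteq> REAL C \<and> \<gamma> 0 = x \<and>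
     (\<forall>t\<in>{0..1}. equivalent C (\<gamma> t) x)"

definition trivial_motion ::
  "('v, 'f) combinatorial_type \<Rightarrow> ('v, 'f) config \<Rightarrow> (real \<Rightarrow> ('v, 'f) config) \<Rightarrow> bool" where
  "trivial_motion C x \<gamma> \<longleftrightarrow> (\<forall>t\<in>{0..1}. congruent_config C (\<gamma> t) x)"

definition rigid_config :: "('v, 'f) combinatorial_type \<Rightarrow> ('v, 'f) config \<Rightarrow> bool" where
  "rigid_config C x \<longleftrightarrow> (\<forall>\<gamma>. is_motion C x \<gamma> \<longrightarrow> trivial_motion C x \<gamma>)"

text \<open>
  The description operator only serves to pick the two endpoints of an unordered pair: the value is
  independent of their order, see \<open>edge_length_map_edge\<close>.
\<close>

definition edge_length_map ::
  "('v, 'f) combinatorial_type \<Rightarrow> ('v, 'f) config \<Rightarrow> ('v set \<Rightarrow> real)" where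
  "edge_length_map C x =
     (\<lambda>e\<in>Edges C. THE l. \<exists>i j. e = {i, j} \<and> l = 1/2 * (norm (fst x i - fst x j))\<^sup>2)"

lemma edge_length_map_edge:
  assumes "{i, j} \<in> Edges C"
  shows "edge_length_map C x {i, j} = 1/2 * (norm (fst x i - fst x j))\<^sup>2"
proof -
  have "(THE l. \<exists>i' j'. {i, j} = {i', j'} \<and> l = 1/2 * (norm (fst x i' - fst x j'))\<^sup>2) =
      1/2 * (norm (fst x i - fst x j))\<^sup>2"
    by (rule the_equality) (auto simp: doubleton_eq_iff norm_minus_commute)
  then show ?thesis using assms by (simp only: edge_length_map_def restrict_apply' if_True)
qed

definition edge_length_space :: "('v, 'f) combinatorial_type \<Rightarrow> ('v set \<Rightarrow> real) set" where
  "edge_length_space C = Edges C \<rightarrow>\<^sub>E UNIV"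

definition edge_length_perturbations_realizable ::
  "('v, 'f) combinatorial_type \<Rightarrow> ('v, 'f) config \<Rightarrow> bool" where
  "edge_length_perturbations_realizable C x \<longleftrightarrow>
     (\<exists>\<psi>. continuous_on (edge_length_space C) \<psi> \<and>
        \<psi> ` edge_length_space C \<subseteq> REAL C \<and>
        \<psi> (edge_length_map C x) = x \<and>
        (\<exists>U. openin (top_of_set (edge_length_space C)) U \<and> edge_length_map C x \<in> U \<and>
             inj_on \<psi> U) \<and>
        (\<exists>U. openin (top_of_set (edge_length_space C)) U \<and> edge_length_map C x \<in> U \<and>
             (\<forall>y\<in>U. edge_length_map C (\<psi> y) = y)))"

definition polytope_type ::
  "(real^3) set \<Rightarrow> (real^3, (real^3) set) combinatorial_type" where
  "polytope_type P =
     \<lparr>Verts = {v. v extreme_point_of P},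
      Edges = {{i, j} | i j. closed_segment i j edge_of P},
      Facets = {\<sigma>. \<sigma> facet_of P},
      incident = (\<lambda>i \<sigma>. i \<in> \<sigma>)\<rparr>"

text \<open>
  The outward normal of a facet, scaled so that the facet lies in the plane \<open>x \<bullet> a = 1\<close>;
  see \<open>facet_normal_eqI\<close> and \<open>facet_normal\<close> for existence and uniqueness.
\<close>

definition facet_normal :: "(real^3) set \<Rightarrow> (real^3) set \<Rightarrow> real^3" where
  "facet_normal P \<sigma> = (THE a. (\<forall>x\<in>P. x \<bullet> a \<le> 1) \<and> \<sigma> = {x \<in> P. x \<bullet> a = 1})"

lemma facet_normal_eqI:
  assumes "\<sigma> facet_of P" "aff_dim P = 3" "\<forall>x\<in>P. x \<bullet> a \<le> 1" "\<sigma> = {x \<in> P. x \<bullet> a = 1}"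
  shows "facet_normal P \<sigma> = a"
  unfolding facet_normal_def
proof (rule the_equality)
  show "(\<forall>x\<in>P. x \<bullet> a \<le> 1) \<and> \<sigma> = {x \<in> P. x \<bullet> a = 1}" using assms by auto
  fix c assume c: "(\<forall>x\<in>P. x \<bullet> c \<le> 1) \<and> \<sigma> = {x \<in> P. x \<bullet> c = 1}"
  have dim: "aff_dim \<sigma> = 2" and ne: "\<sigma> \<noteq> {}"
    using assms(1,2) by (auto simp: facet_of_def)
  have hull: "affine hull \<sigma> = {x. b \<bullet> x = 1}" if b: "\<sigma> = {x \<in> P. x \<bullet> b = 1}" for b
  proof -
    have nz: "b \<noteq> 0" using b ne by auto
    have "affine hull \<sigma> \<subseteq> {x. b \<bullet> x = 1}"
      by (rule hull_minimal) (use b in \<open>simp_all add: affine_hyperplane\<close>, auto simp: inner_commute)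
    moreover have "aff_dim {x. b \<bullet> x = 1} = 2" using nz by simp
    ultimately show ?thesis
      using dim ne by (intro affine_dim_equal) (auto simp: affine_hyperplane)
  qed
  have eq: "{x. a \<bullet> x = 1} = {x. c \<bullet> x = 1}" using hull[OF assms(4)] hull c by blast
  have nz: "a \<noteq> 0" "c \<noteq> 0" using assms(4) c ne by auto
  have "a /\<^sub>R (a \<bullet> a) \<in> {x. a \<bullet> x = 1}" "c /\<^sub>R (c \<bullet> c) \<in> {x. c \<bullet> x = 1}" using nz by auto
  then have "c \<bullet> (a /\<^sub>R (a \<bullet> a)) = 1" "a \<bullet> (c /\<^sub>R (c \<bullet> c)) = 1" using eq by blast+
  then have "c \<bullet> a = a \<bullet> a" "a \<bullet> c = c \<bullet> c" using nz by (auto simp: field_simps)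
  then have "(c - a) \<bullet> (c - a) = 0" by (simp add: inner_diff inner_commute)
  then show "c = a" by simp
qed

lemma facet_normal:
  assumes "polytope P" "aff_dim P = 3" "0 \<in> interior P" "\<sigma> facet_of P"
  shows "\<forall>x\<in>P. x \<bullet> facet_normal P \<sigma> \<le> 1" "\<sigma> = {x \<in> P. x \<bullet> facet_normal P \<sigma> = 1}"
proof -
  have "\<sigma> exposed_face_of P" "\<sigma> \<noteq> {}" "\<sigma> \<noteq> P"
    using assms by (auto simp: exposed_face_of_polyhedron polytope_imp_polyhedron facet_of_def)
  then obtain a b where ab: "a \<noteq> 0" "P \<subseteq> {x. a \<bullet> x \<le> b}" "\<sigma> = P \<inter> {x. a \<bullet> x = b}"
    by (auto simp: exposed_face_of)
  obtain e where e: "e > 0" "cball 0 e \<subseteq> P"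
    using assms(3) by (meson mem_interior_cball)
  have "(e / norm a) *\<^sub>R a \<in> P" using e ab(1) by (intro subsetD[OF e(2)]) auto
  then have "(e / norm a) * (a \<bullet> a) \<le> b" using ab(2) by auto
  moreover have "(e / norm a) * (a \<bullet> a) > 0" using e ab(1) by auto
  ultimately have b: "b > 0" by linarith
  have *: "\<forall>x\<in>P. x \<bullet> (a /\<^sub>R b) \<le> 1" "\<sigma> = {x \<in> P. x \<bullet> (a /\<^sub>R b) = 1}"
    using ab(2,3) b by (auto simp: inner_commute field_simps)
  then have "facet_normal P \<sigma> = a /\<^sub>R b" using facet_normal_eqI assms by blast
  then show "\<forall>x\<in>P. x \<bullet> facet_normal P \<sigma> \<le> 1" "\<sigma> = {x \<in> P. x \<bullet> facet_normal P \<sigma> = 1}"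
    using * by auto
qed

definition polytope_config :: "(real^3) set \<Rightarrow> (real^3, (real^3) set) config" where
  "polytope_config P =
     (\<lambda>v\<in>Verts (polytope_type P). v,
      \<lambda>\<sigma>\<in>Facets (polytope_type P). facet_normal P \<sigma>)"

lemma polytope_config_in_REAL:
  assumes "polytope P" "aff_dim P = 3" "0 \<in> interior P"
  shows "polytope_config P \<in> REAL (polytope_type P)"
proof -
  have "(v \<in> \<sigma> \<longrightarrow> v \<bullet> facet_normal P \<sigma> = 1) \<and> (v \<notin> \<sigma> \<longrightarrow> v \<bullet> facet_normal P \<sigma> < 1)"
    if v: "v extreme_point_of P" and \<sigma>: "\<sigma> facet_of P" for v \<sigma>
  proof -
    have "v \<in> P" using v by (simp add: extreme_point_of_def)
    then have "v \<bullet> facet_normal P \<sigma> \<le> 1" "v \<in> \<sigma> \<longleftrightarrow> v \<bullet> facet_normal P \<sigma> = 1"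
      using facet_normal[OF assms \<sigma>] by blast+
    then show ?thesis by auto
  qed
  then show ?thesis by (auto simp: REAL_def polytope_config_def polytope_type_def)
qed

end

(*
  Near P the realization space injects continuously into R^(|E| + 6). Sweeping a
  generic plane over P shows that every nonempty set of vertices and facets has an element
  incident to at most three others of the set; removing such elements one by one leaves, for each
  of them, at most three independent linear conditions on its position, the remaining coordinates
  being free. The number of free coordinates is 3 |V| + 3 |F| - I, where I counts incidences. The
  sweep also gives I >= 2 |V| + 2 |F| - 4, and counting flags gives I <= 2 |E|.

  Moving psi x by the rigid motions near the identity turns psi into a continuous map of |E| + 6
  parameters, injective since the edge lengths recover x and the vertices, which affinely span
  space, recover the rigid motion. By invariance of domain its image contains a neighbourhood of P, so every
  realization close to P is a rigid motion of some psi x; if it is equivalent to P, then x is the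
  edge length vector of P and the realization is congruent to P. Finally, the set of times at
  which a motion is congruent to P is closed, and it is open because a realization congruent to P
  can be moved back to P by an isometry.
*)

theory Submission
  imports Defs "HOL-Homology.Homology"
begin

section \<open>Vertices and facet normals\<close>

text \<open>Invariance of domain needs a target of no larger dimension than the parameter space, and
  the combinatorics has to supply this: the 6 in the coordinate count is the dimension of the group
  of rigid motions, three for \<open>rot\<close> and three for translations. The elimination stops
  at degree three because space holds no more than three independent conditions; any three vertices
  of a facet, or normals at a vertex, are independent, since they lie in a plane missing the origin
  and none is between two others. Degree three is always available because the sweep bounds the
  incidences of every nonempty sub-family by \<open>2 * card A + 2 * card B - 2\<close>, so the
  average degree is below 4. The sweep works since the section of \<open>P\<close> at the height of
  an intermediate vertex is a polygon with a corner there, and a corner has two sides. The local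
  statement is formulated for the incidence equations alone, because the isometry that moves a
  realization back to \<open>P\<close> shifts the origin and rescales the normals by factors that
  are only shown to be nonzero.\<close>

lemma independent_if_no_between:
  fixes S :: "(real^3) set"
  assumes fin: "finite S" and card: "card S \<le> 3" and one: "\<And>s. s \<in> S \<Longrightarrow> s \<bullet> v = 1"
    and nb: "\<And>a b c. \<lbrakk>a \<in> S; b \<in> S; c \<in> S\<rbrakk> \<Longrightarrow> b \<notin> open_segment a c"
  shows "independent S"
proof
  assume "dependent S"
  then obtain u s where u: "s \<in> S" "u s \<noteq> 0" "(\<Sum>w\<in>S. u w *\<^sub>R w) = 0"
    using dependent_finite[OF fin] by auto
  \<comment> \<open>All of \<open>S\<close> lies in the plane of points whose inner product with
    \<open>v\<close> is 1, so pairing a linear relation with \<open>v\<close> shows that its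
    coefficients sum to 0: it is an affine relation.\<close>
  have "(\<Sum>w\<in>S. u w) = (\<Sum>w\<in>S. u w *\<^sub>R w) \<bullet> v"
    by (simp add: inner_sum_left one)
  then have "(\<Sum>w\<in>S. u w) = 0" using u by simp
  then have "affine_dependent S"
    unfolding affine_dependent_explicit_finite[OF fin] using u by blast
  then obtain x where x: "x \<in> S" "x \<in> affine hull (S - {x})"
    unfolding affine_dependent_def by blast
  have "S - {x} \<noteq> {}"
  proof
    assume "S - {x} = {}"
    then show False using x(2) by (simp only: affine_hull_empty empty_iff)
  qed
  then have "card (S - {x}) = 1 \<or> card (S - {x}) = 2"
    using card x(1) fin card_gt_0_iff[of "S - {x}"] by auto
  then have "\<exists>a b. S - {x} = {a, b}"
    by (metis card_1_singletonE card_2_iff insert_absorb2)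
  then obtain a b where ab: "S - {x} = {a, b}" by blast
  \<comment> \<open>With at most three points an affine dependence means collinearity.
    \<open>a\<close> and \<open>b\<close> may still coincide here; this is excluded below.\<close>
  have "collinear {x, a, b}"
    using x(2) ab hull_subset[of "{a, b}" affine] by (auto simp: collinear_affine_hull)
  then have "between (a, b) x \<or> between (b, x) a \<or> between (x, a) b"
    by (simp add: collinear_between_cases)
  moreover have "a \<noteq> x" "b \<noteq> x" "a \<in> S" "b \<in> S" using ab by auto
  moreover have "a \<noteq> b"
  proof
    assume "a = b"
    then have "x \<in> affine hull {b}" using x(2) ab by simp
    then show False using \<open>b \<noteq> x\<close> by simp
  qed
  ultimately show False
    using nb[of a x b] nb[of b a x] nb[of x b a] x(1)
    by (auto simp: between_mem_segment closed_segment_eq_open)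
qed

locale polytope3 =
  fixes P :: "(real^3) set"
  assumes poly: "polytope P" and dim3: "aff_dim P = 3" and zero: "0 \<in> interior P"
begin

definition "V = {v. v extreme_point_of P}"
definition "F = {\<sigma>. \<sigma> facet_of P}"
definition "N = facet_normal P"

lemma finite_V: "finite V"
  unfolding V_def by (simp add: finite_polyhedron_extreme_points poly polytope_imp_polyhedron)

lemma finite_F: "finite F"
  unfolding F_def by (simp add: finite_polytope_facets poly)

lemma VP: "v \<in> V \<Longrightarrow> v \<in> P"
  by (simp add: V_def extreme_point_of_def)

lemma convP: "convex P" and compP: "compact P"
  using poly polytope_imp_convex polytope_imp_compact by auto

lemma N_le: "\<sigma> \<in> F \<Longrightarrow> x \<in> P \<Longrightarrow> N \<sigma> \<bullet> x \<le> 1"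
  using facet_normal(1)[OF poly dim3 zero] by (auto simp: F_def N_def inner_commute)

lemma mem_F: "\<sigma> \<in> F \<Longrightarrow> x \<in> \<sigma> \<longleftrightarrow> x \<in> P \<and> N \<sigma> \<bullet> x = 1"
  using facet_normal(2)[OF poly dim3 zero, of \<sigma>] by (auto simp: F_def N_def inner_commute)

lemma F_face: "\<sigma> \<in> F \<Longrightarrow> \<sigma> face_of P" "\<sigma> \<in> F \<Longrightarrow> aff_dim \<sigma> = 2"
  by (auto simp: F_def facet_of_def dim3)

lemma face_polytope: "\<sigma> face_of P \<Longrightarrow> polytope \<sigma>"
  using poly by (rule face_of_polytope_polytope)

lemma face_hull: "\<sigma> face_of P \<Longrightarrow> \<sigma> = convex hull (V \<inter> \<sigma>)"
  using Krein_Milman_Minkowski[of \<sigma>] face_polytope[of \<sigma>]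
  by (simp add: polytope_imp_compact polytope_imp_convex extreme_point_of_face V_def Int_def)

lemma P_hull: "P = convex hull V"
  using face_hull[OF face_of_refl[OF convP]] VP by (simp add: Int_absorb2 subset_iff)

lemma N_lt_interior:
  assumes "x \<in> interior P" "\<sigma> \<in> F"
  shows "N \<sigma> \<bullet> x < 1"
proof -
  have "\<sigma> \<noteq> P" using F_face[OF assms(2)] dim3 by auto
  then have "\<sigma> \<inter> interior P = {}"
    by (rule face_of_disjoint_interior[OF F_face(1)[OF assms(2)]])
  then have "x \<notin> \<sigma>" using assms by auto
  moreover have "x \<in> P" using assms interior_subset by auto
  ultimately show ?thesis using mem_F[OF assms(2)] N_le[OF assms(2)] by fastforce
qed

text \<open>For \<open>x\<close> outside \<open>P\<close>, the segment from the interior point 0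
  leaves \<open>P\<close> at a multiple \<open>y\<close> of \<open>x\<close> on some facet, where
  the functional is 1. As the functional is at most 1 at \<open>x\<close>, this forces
  \<open>y = x\<close>.\<close>

lemma mem_P: "x \<in> P \<longleftrightarrow> (\<forall>\<sigma>\<in>F. N \<sigma> \<bullet> x \<le> 1)"
proof
  assume *: "\<forall>\<sigma>\<in>F. N \<sigma> \<bullet> x \<le> 1"
  show "x \<in> P"
  proof (rule ccontr)
    assume x: "x \<notin> P"
    have "closed_segment 0 x \<inter> frontier P \<noteq> {}"
      using zero x interior_subset
      by (intro connected_Int_frontier) auto
    then obtain y where y: "y \<in> closed_segment 0 x" "y \<in> frontier P" by auto
    then obtain t where t: "0 \<le> t" "t \<le> 1" "y = t *\<^sub>R x" by (auto simp: in_segment)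
    have "y \<in> P - rel_interior P"
      using y(2) zero polytope_imp_closed[OF poly] rel_interior_nonempty_interior[of P]
      by (auto simp: frontier_def)
    then obtain \<sigma> where \<sigma>: "\<sigma> \<in> F" "y \<in> \<sigma>"
      using rel_boundary_of_polyhedron[of P] poly polytope_imp_polyhedron by (auto simp: F_def)
    then have 1: "t * (N \<sigma> \<bullet> x) = 1" using mem_F t by auto
    have "N \<sigma> \<bullet> x \<le> 1" using * \<sigma> by auto
    then have "t * (N \<sigma> \<bullet> x) \<le> t" using t mult_left_le by blast
    then have "t = 1" using 1 t by auto
    then have "y = x" using t by simp
    moreover have "y \<in> P" using \<sigma> mem_F by auto
    ultimately show False using x by simp
  qed
qed (use N_le in auto)

text \<open>A proper face of a facet has smaller dimension, while both facets have dimension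
  2.\<close>

lemma facet_subset_eq:
  assumes "\<sigma> \<in> F" "\<tau> \<in> F" "V \<inter> \<sigma> \<subseteq> \<tau>" shows "\<sigma> = \<tau>"
proof (rule ccontr)
  assume "\<sigma> \<noteq> \<tau>"
  have "\<sigma> \<subseteq> \<tau>"
    using face_hull[OF F_face(1)[OF assms(1)]] assms(3) F_face(1)[OF assms(2)]
    by (metis face_of_imp_convex hull_minimal)
  then have "\<sigma> face_of \<tau>"
    by (meson F_face assms face_of_face)
  then have "aff_dim \<sigma> < aff_dim \<tau>"
    using \<open>\<sigma> \<noteq> \<tau>\<close> F_face assms face_of_aff_dim_lt face_of_imp_convex by blast
  then show False using F_face assms by simp
qed

lemma aff_dim_facets_Int:
  assumes "\<sigma> \<in> F" "\<tau> \<in> F" "\<sigma> \<noteq> \<tau>" shows "aff_dim (\<sigma> \<inter> \<tau>) \<le> 1"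
proof -
  have "\<sigma> \<inter> \<tau> \<noteq> \<sigma>" using facet_subset_eq assms by blast
  moreover have "\<sigma> \<inter> \<tau> face_of \<sigma>"
    by (meson F_face assms face_of_Int face_of_face inf_le1)
  ultimately have "aff_dim (\<sigma> \<inter> \<tau>) < aff_dim \<sigma>"
    using F_face assms face_of_aff_dim_lt face_of_imp_convex by blast
  then show ?thesis using F_face assms by simp
qed

section \<open>General position of vertices on a facet and of normals at a vertex\<close>

lemma V_not_between: "\<lbrakk>a \<in> P; c \<in> P; b \<in> V\<rbrakk> \<Longrightarrow> b \<notin> open_segment a c"
  by (auto simp: V_def extreme_point_of_def)

text \<open>A strict convex combination of two functionals that are at most 1 on \<open>P\<close>
  equals 1 only where both do, so \<open>\<sigma>\<close> would lie in \<open>\<rho>\<close> and in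
  \<open>\<tau>\<close>, and all three would coincide. This is the polar counterpart of
  \<open>V_not_between\<close>.\<close>

lemma N_not_between:
  assumes "\<rho> \<in> F" "\<sigma> \<in> F" "\<tau> \<in> F" shows "N \<sigma> \<notin> open_segment (N \<rho>) (N \<tau>)"
proof
  assume a: "N \<sigma> \<in> open_segment (N \<rho>) (N \<tau>)"
  then obtain u where u: "0 < u" "u < 1" "N \<sigma> = (1 - u) *\<^sub>R N \<rho> + u *\<^sub>R N \<tau>"
    and ne: "N \<rho> \<noteq> N \<tau>" by (auto simp: in_segment)
  have "x \<in> \<rho> \<inter> \<tau>" if x: "x \<in> \<sigma>" for x
  proof -
    have "x \<in> P" "(1 - u) * (N \<rho> \<bullet> x) + u * (N \<tau> \<bullet> x) = 1"
      using x mem_F[OF assms(2)] u(3) by (auto simp: inner_add_left)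
    moreover from \<open>x \<in> P\<close> have "N \<rho> \<bullet> x \<le> 1" "N \<tau> \<bullet> x \<le> 1" using N_le assms by auto
    moreover have "(1 - u) * (1 - N \<rho> \<bullet> x) + u * (1 - N \<tau> \<bullet> x) = 0"
      using calculation by (simp add: algebra_simps)
    then have "(1 - u) * (1 - N \<rho> \<bullet> x) = 0 \<and> u * (1 - N \<tau> \<bullet> x) = 0"
      using u calculation by (subst (asm) add_nonneg_eq_0_iff) auto
    ultimately show ?thesis using u mem_F assms by auto
  qed
  then have "\<sigma> \<subseteq> \<rho> \<inter> \<tau>" by auto
  then have "\<sigma> = \<rho>" "\<sigma> = \<tau>" using facet_subset_eq assms by blast+
  then show False using ne by simp
qed

lemma N_inj: "\<sigma> \<in> F \<Longrightarrow> \<tau> \<in> F \<Longrightarrow> N \<sigma> = N \<tau> \<Longrightarrow> \<sigma> = \<tau>"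
  by (rule facet_subset_eq) (auto simp: mem_F)

lemma independent_vertices:
  assumes "\<sigma> \<in> F" "D \<subseteq> V \<inter> \<sigma>" "card D \<le> 3" shows "independent D"
proof (rule independent_if_no_between[where v = "N \<sigma>"])
  show "finite D" using assms finite_V finite_subset by blast
  show "b \<notin> open_segment a c" if "a \<in> D" "b \<in> D" "c \<in> D" for a b c
    using that assms V_not_between VP by blast
  show "s \<bullet> N \<sigma> = 1" if "s \<in> D" for s
    using that assms mem_F by (auto simp: inner_commute)
qed (use assms in auto)

lemma independent_normals:
  assumes "v \<in> V" "D \<subseteq> {\<sigma>\<in>F. v \<in> \<sigma>}" "card D \<le> 3" shows "inj_on N D" "independent (N ` D)"
proof -
  have fin: "finite D" using assms finite_F finite_subset by fastforce
  show "inj_on N D" using assms N_inj unfolding inj_on_def by blast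
  show "independent (N ` D)"
  proof (rule independent_if_no_between[where v = v])
    show "finite (N ` D)" using fin by simp
    show "card (N ` D) \<le> 3" using card_image_le[OF fin, of N] assms by linarith
    show "b \<notin> open_segment a c" if "a \<in> N ` D" "b \<in> N ` D" "c \<in> N ` D" for a b c
      using that assms N_not_between by blast
    show "s \<bullet> v = 1" if "s \<in> N ` D" for s
      using that assms mem_F by auto
  qed
qed

text \<open>Three such facets would have linearly independent normals, all orthogonal to
  \<open>i - j\<close> and hence in a plane.\<close>

lemma edge_two_facets:
  assumes "i \<noteq> j" "i \<in> V" "j \<in> V"
  shows "card {\<sigma>\<in>F. i \<in> \<sigma> \<and> j \<in> \<sigma>} \<le> 2"
proof (rule ccontr)
  let ?A = "{\<sigma>\<in>F. i \<in> \<sigma> \<and> j \<in> \<sigma>}"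
  assume "\<not> ?thesis"
  then have "3 \<le> card ?A" by simp
  then obtain D where D: "D \<subseteq> ?A" "card D = 3"
    by (meson obtain_subset_with_card_n)
  have *: "inj_on N D" "independent (N ` D)"
    using independent_normals[of i D] D assms by auto
  have "N ` D \<subseteq> {x. (i - j) \<bullet> x = 0}"
  proof clarify
    fix \<sigma> assume "\<sigma> \<in> D"
    then have "N \<sigma> \<bullet> i = 1" "N \<sigma> \<bullet> j = 1" using D mem_F by blast+
    then show "(i - j) \<bullet> N \<sigma> = 0"
      by (simp add: inner_diff_left inner_commute[of i] inner_commute[of j])
  qed
  moreover have "dim {x. (i - j) \<bullet> x = 0} = 2" using assms by (simp add: dim_hyperplane)
  ultimately have "card (N ` D) \<le> 2"
    using *(2) independent_card_le_dim by metis
  then show False using card_image[OF *(1)] D by simp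
qed

text \<open>Constraints tight at \<open>v\<close> do not increase along \<open>d\<close>, and the
  finitely many slack ones survive a short step.\<close>

lemma feasible_direction:
  assumes v: "v \<in> P" and d: "\<And>\<sigma>. \<sigma> \<in> F \<Longrightarrow> v \<in> \<sigma> \<Longrightarrow> N \<sigma> \<bullet> d \<le> 0"
  obtains e where "e > 0" "v + e *\<^sub>R d \<in> P"
proof -
  have "\<forall>\<^sub>F t in at_right 0. N \<sigma> \<bullet> (v + t *\<^sub>R d) \<le> 1" if \<sigma>: "\<sigma> \<in> F" for \<sigma>
  proof (cases "v \<in> \<sigma>")
    case True
    show ?thesis
      using d[OF \<sigma> True] mem_F[OF \<sigma>, of v] True eventually_at_right_less[of 0]
      by (auto simp: inner_add_right mult_nonneg_nonpos elim!: eventually_mono)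
  next
    case False
    then have "N \<sigma> \<bullet> (v + 0 *\<^sub>R d) < 1"
      using mem_F[OF \<sigma>, of v] N_le[OF \<sigma> v] v by auto
    moreover have "((\<lambda>t. N \<sigma> \<bullet> (v + t *\<^sub>R d)) \<longlongrightarrow> N \<sigma> \<bullet> (v + 0 *\<^sub>R d)) (at_right 0)"
      by (intro tendsto_intros)
    ultimately show ?thesis
      by (intro eventually_mono[OF order_tendstoD(2)]) auto
  qed
  then have "\<forall>\<^sub>F t in at_right 0. \<forall>\<sigma>\<in>F. N \<sigma> \<bullet> (v + t *\<^sub>R d) \<le> 1"
    by (simp add: eventually_ball_finite finite_F)
  moreover have "\<forall>\<^sub>F t in at_right (0::real). 0 < t"
    by (rule eventually_at_right_less)
  ultimately have "\<forall>\<^sub>F t in at_right 0. 0 < t \<and> v + t *\<^sub>R d \<in> P"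
    by eventually_elim (simp add: mem_P)
  then show ?thesis
    using that eventually_happens trivial_limit_at_right_real by blast
qed

text \<open>Otherwise both \<open>d\<close> and \<open>- d\<close> would be feasible at
  \<open>v\<close>, which would put \<open>v\<close> inside a segment of \<open>P\<close>.\<close>

lemma normals_span:
  assumes "v \<in> V" "\<And>\<sigma>. \<sigma> \<in> F \<Longrightarrow> v \<in> \<sigma> \<Longrightarrow> N \<sigma> \<bullet> d = 0"
  shows "d = 0"
proof (rule ccontr)
  assume d: "d \<noteq> 0"
  obtain e where e: "e > 0" "v + e *\<^sub>R d \<in> P"
    using feasible_direction[of v d] assms VP by force
  obtain e' where e': "e' > 0" "v + e' *\<^sub>R (- d) \<in> P"
    using feasible_direction[of v "- d"] assms VP by force
  \<comment> \<open>The weight at which the displacements \<open>e\<close> and \<open>- e'\<close>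
    along \<open>d\<close> cancel.\<close>
  define s where "s = e' / (e + e')"
  have s: "0 < s" "s < 1" "s * e - (1 - s) * e' = 0"
    using e e' by (auto simp: s_def field_simps)
  have "(1 - s) *\<^sub>R (v + e' *\<^sub>R (- d)) + s *\<^sub>R (v + e *\<^sub>R d) = v + (s * e - (1 - s) * e') *\<^sub>R d"
    by (simp add: algebra_simps)
  then have "v = (1 - s) *\<^sub>R (v + e' *\<^sub>R (- d)) + s *\<^sub>R (v + e *\<^sub>R d)"
    unfolding s by simp
  moreover have "v + e *\<^sub>R d \<noteq> v + e' *\<^sub>R (- d)"
  proof
    assume "v + e *\<^sub>R d = v + e' *\<^sub>R (- d)"
    then have "(e + e') *\<^sub>R d = 0" by (simp add: algebra_simps)
    then show False using e e' d by auto
  qed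
  ultimately have "v \<in> open_segment (v + e' *\<^sub>R (- d)) (v + e *\<^sub>R d)"
    using s unfolding in_segment by (intro conjI exI[of _ s]) auto
  then show False using V_not_between e e' assms(1) by blast
qed

text \<open>
  A polygonal cone has two sides: the ray through \<open>d0 + t *\<^sub>R e\<close> leaves the cone on either side of
  \<open>t = 0\<close>, and the constraint it violates first contains a side.
\<close>

lemma two_sides:
  fixes h d0 :: "real^3"
  assumes fin: "finite T" and d0: "h \<bullet> d0 = 0" "\<And>\<sigma>. \<sigma> \<in> T \<Longrightarrow> n \<sigma> \<bullet> d0 < 0"
    and ne: "T \<noteq> {}"
    and pointed: "\<And>d. h \<bullet> d = 0 \<Longrightarrow> (\<And>\<sigma>. \<sigma> \<in> T \<Longrightarrow> n \<sigma> \<bullet> d = 0) \<Longrightarrow> d = 0"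
  obtains \<rho> \<tau> d d' where "\<rho> \<in> T" "\<tau> \<in> T" "\<rho> \<noteq> \<tau>" "h \<bullet> d = 0" "h \<bullet> d' = 0"
    "n \<rho> \<bullet> d = 0" "n \<tau> \<bullet> d' = 0" "d \<noteq> 0" "d' \<noteq> 0"
    "\<And>\<sigma>. \<sigma> \<in> T \<Longrightarrow> n \<sigma> \<bullet> d \<le> 0" "\<And>\<sigma>. \<sigma> \<in> T \<Longrightarrow> n \<sigma> \<bullet> d' \<le> 0"
proof -
  \<comment> \<open>\<open>c\<close> pairs negatively with \<open>d0\<close>, so for
    \<open>e\<close> orthogonal to \<open>c\<close> the line \<open>d0 + t *\<^sub>R e\<close>
    avoids 0. Moreover the values \<open>n \<sigma> \<bullet> e\<close> then sum to 0 without all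
    vanishing, so one of them is positive.\<close>
  define c where "c = (\<Sum>\<sigma>\<in>T. n \<sigma>)"
  have side: "\<exists>\<rho>\<in>T. \<exists>d. h \<bullet> d = 0 \<and> n \<rho> \<bullet> d = 0 \<and> n \<rho> \<bullet> e > 0 \<and> d \<noteq> 0 \<and> (\<forall>\<sigma>\<in>T. n \<sigma> \<bullet> d \<le> 0)"
    if e: "e \<noteq> 0" "h \<bullet> e = 0" "c \<bullet> e = 0" for e
  proof -
    define T' where "T' = {\<sigma>\<in>T. n \<sigma> \<bullet> e > 0}"
    have "T' \<noteq> {}"
    proof
      assume "T' = {}"
      then have le: "\<forall>\<sigma>\<in>T. 0 \<le> - (n \<sigma> \<bullet> e)" by (auto simp: T'_def not_less)
      have "(\<Sum>\<sigma>\<in>T. - (n \<sigma> \<bullet> e)) = 0" using e(3) by (simp add: c_def inner_sum_left sum_negf)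
      then have "\<forall>\<sigma>\<in>T. - (n \<sigma> \<bullet> e) = 0" using le fin by (subst (asm) sum_nonneg_eq_0_iff) auto
      then show False using pointed[OF e(2)] e(1) by auto
    qed
    moreover have "finite T'" using fin by (simp add: T'_def)
    ultimately obtain \<rho> where \<rho>: "\<rho> \<in> T'"
        "\<And>\<sigma>. \<sigma> \<in> T' \<Longrightarrow> - (n \<rho> \<bullet> d0) / (n \<rho> \<bullet> e) \<le> - (n \<sigma> \<bullet> d0) / (n \<sigma> \<bullet> e)"
      using ex_is_arg_min_if_finite[of T' "\<lambda>\<sigma>. - (n \<sigma> \<bullet> d0) / (n \<sigma> \<bullet> e)"]
      by (auto simp: is_arg_min_linorder)
    \<comment> \<open>The first time at which the ray from \<open>d0\<close> along \<open>e\<close>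
      makes a constraint tight; \<open>\<rho>\<close> is that constraint.\<close>
    define t where "t = - (n \<rho> \<bullet> d0) / (n \<rho> \<bullet> e)"
    have \<rho>T: "\<rho> \<in> T" "n \<rho> \<bullet> e > 0" using \<rho> by (auto simp: T'_def)
    have t: "t > 0" unfolding t_def using d0(2)[of \<rho>] \<rho>T by (intro divide_pos_pos) auto
    have "n \<sigma> \<bullet> (d0 + t *\<^sub>R e) \<le> 0" if \<sigma>: "\<sigma> \<in> T" for \<sigma>
    proof (cases "\<sigma> \<in> T'")
      case True
      then have "t \<le> - (n \<sigma> \<bullet> d0) / (n \<sigma> \<bullet> e)" using \<rho>(2) by (simp add: t_def)
      then show ?thesis using True by (simp add: T'_def inner_add_right field_simps)
    next
      case False
      then have "t * (n \<sigma> \<bullet> e) \<le> 0" using t \<sigma> by (auto simp: T'_def mult_nonneg_nonpos)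
      then show ?thesis using d0(2)[OF \<sigma>] by (simp add: inner_add_right)
    qed
    moreover have "d0 + t *\<^sub>R e \<noteq> 0"
    proof
      assume "d0 + t *\<^sub>R e = 0"
      then have "c \<bullet> (d0 + t *\<^sub>R e) = 0" by simp
      then have "c \<bullet> d0 = 0" using e by (simp add: inner_add_right)
      moreover have "c \<bullet> d0 < 0"
        unfolding c_def inner_sum_left
        using sum_strict_mono[of T "\<lambda>\<sigma>. n \<sigma> \<bullet> d0" "\<lambda>_. 0"] d0(2) ne fin by simp
      ultimately show False by simp
    qed
    moreover have "n \<rho> \<bullet> (d0 + t *\<^sub>R e) = 0" using \<rho>T by (simp add: t_def inner_diff_right)
    moreover have "h \<bullet> (d0 + t *\<^sub>R e) = 0" using d0 e by (simp add: inner_add_right)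
    ultimately show ?thesis using \<rho>T by blast
  qed
  \<comment> \<open>\<open>h\<close> and \<open>c\<close> span at most a plane, so some nonzero
    \<open>e\<close> is orthogonal to both. The directions \<open>e\<close> and \<open>- e\<close>
    yield the two sides, which are distinct because \<open>\<rho>\<close> increases and
    \<open>\<tau>\<close> decreases along \<open>e\<close>.\<close>
  have "dim (span {h, c}) \<le> card {h, c}" unfolding dim_span by (rule dim_le_card') simp
  also have "\<dots> \<le> 2" by (simp add: card_insert_if)
  finally have "dim (span {h, c}) < DIM(real^3)" by simp
  then obtain e :: "real^3" where e: "e \<noteq> 0" "\<And>y. y \<in> span {h, c} \<Longrightarrow> orthogonal e y"
    using orthogonal_to_subspace_exists[of "{h, c}"] by (auto simp: dim_span)
  have eo: "h \<bullet> e = 0" "c \<bullet> e = 0"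
    using e(2)[of h] e(2)[of c] by (simp_all add: orthogonal_def inner_commute span_base)
  from side[OF e(1) eo] obtain \<rho> d where \<rho>: "\<rho> \<in> T" "h \<bullet> d = 0" "n \<rho> \<bullet> d = 0" "n \<rho> \<bullet> e > 0"
      "d \<noteq> 0" "\<forall>\<sigma>\<in>T. n \<sigma> \<bullet> d \<le> 0" by blast
  from side[of "- e"] e eo obtain \<tau> d' where \<tau>: "\<tau> \<in> T" "h \<bullet> d' = 0" "n \<tau> \<bullet> d' = 0"
      "n \<tau> \<bullet> e < 0" "d' \<noteq> 0" "\<forall>\<sigma>\<in>T. n \<sigma> \<bullet> d' \<le> 0" by auto
  have "\<rho> \<noteq> \<tau>" using \<rho> \<tau> by auto
  then show ?thesis using that \<rho> \<tau> by blast
qed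

end

section \<open>Sweeping a generic plane\<close>

lemma exists_generic_direction:
  fixes V :: "'a::euclidean_space set"
  assumes "finite V"
  obtains h where "inj_on (\<lambda>v. h \<bullet> v) V"
proof -
  have "negligible (\<Union>(u, v)\<in>{(u, v). u \<in> V \<and> v \<in> V \<and> u \<noteq> v}. {h. (u - v) \<bullet> h = 0})"
  proof (rule negligible_Union)
    have "finite {(u, v). u \<in> V \<and> v \<in> V \<and> u \<noteq> v}"
      by (rule finite_subset[of _ "V \<times> V"]) (use assms in auto)
    then show "finite ((\<lambda>(u, v). {h. (u - v) \<bullet> h = 0}) ` {(u, v). u \<in> V \<and> v \<in> V \<and> u \<noteq> v})"
      by simp
  qed (auto intro!: negligible_hyperplane)
  then have "(\<Union>(u, v)\<in>{(u, v). u \<in> V \<and> v \<in> V \<and> u \<noteq> v}. {h. (u - v) \<bullet> h = 0}) \<noteq> UNIV"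
    by (metis non_negligible_UNIV)
  then obtain h where "\<And>u v. u \<in> V \<Longrightarrow> v \<in> V \<Longrightarrow> u \<noteq> v \<Longrightarrow> (u - v) \<bullet> h \<noteq> 0" by auto
  then have "inj_on (\<lambda>v. v \<bullet> h) V"
    by (intro inj_onI) (auto simp: inner_diff_left)
  then have "inj_on (\<lambda>v. h \<bullet> v) V"
    by (simp add: inner_commute)
  then show ?thesis using that by blast
qed

text \<open>The \<open>d i\<close> are linearly dependent, which the sign pattern excludes.\<close>

lemma no_three_sides:
  fixes d n :: "'i \<Rightarrow> real^3"
  assumes h: "h \<noteq> 0" "\<And>i. i \<in> I \<Longrightarrow> h \<bullet> d i = 0"
    and zero: "\<And>i. i \<in> I \<Longrightarrow> n i \<bullet> d i = 0"
    and neg: "\<And>i j. \<lbrakk>i \<in> I; j \<in> I; i \<noteq> j\<rbrakk> \<Longrightarrow> n i \<bullet> d j < 0"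
  shows "card I \<noteq> 3"
proof
  assume "card I = 3"
  then obtain i j k where I: "I = {i, j, k}" "i \<noteq> j" "j \<noteq> k" "i \<noteq> k"
    unfolding card_3_iff by auto
  have inj: "inj_on d I" using zero neg by (metis inj_onI less_irrefl)
  have "\<not> independent (d ` I)"
  proof
    assume "independent (d ` I)"
    moreover have "d ` I \<subseteq> {x. h \<bullet> x = 0}" using h by auto
    ultimately have "card (d ` I) \<le> dim {x. h \<bullet> x = 0}" by (rule independent_card_le_dim[rotated])
    then show False using h(1) \<open>card I = 3\<close> card_image[OF inj] by (simp add: dim_hyperplane)
  qed
  then obtain u where u: "\<exists>v\<in>d ` I. u v \<noteq> 0" "(\<Sum>v\<in>d ` I. u v *\<^sub>R v) = 0"
    using dependent_finite[of "d ` I"] I by auto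
  define c where "c = (\<lambda>i. u (d i))"
  have c: "c i \<noteq> 0 \<or> c j \<noteq> 0 \<or> c k \<noteq> 0" "c i *\<^sub>R d i + c j *\<^sub>R d j + c k *\<^sub>R d k = 0"
    using u inj I by (auto simp: c_def sum.reindex add.assoc)
  have z: "n i \<bullet> d i = 0" "n j \<bullet> d j = 0" "n k \<bullet> d k = 0"
    "n i \<bullet> d j < 0" "n i \<bullet> d k < 0" "n j \<bullet> d i < 0" "n j \<bullet> d k < 0" "n k \<bullet> d i < 0" "n k \<bullet> d j < 0"
    using zero neg I by auto
  have e: "c j * (n i \<bullet> d j) + c k * (n i \<bullet> d k) = 0"
    "c i * (n j \<bullet> d i) + c k * (n j \<bullet> d k) = 0"
    "c i * (n k \<bullet> d i) + c j * (n k \<bullet> d j) = 0"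
    using arg_cong[OF c(2), of "\<lambda>x. n i \<bullet> x"] arg_cong[OF c(2), of "\<lambda>x. n j \<bullet> x"]
      arg_cong[OF c(2), of "\<lambda>x. n k \<bullet> x"] z
    by (simp_all add: inner_add_right)
  \<comment> \<open>Each relation in \<open>e\<close> makes two coefficients either both zero or of
    strictly opposite sign. Three numbers cannot have pairwise opposite signs, so all would
    vanish.\<close>
  have opp: "(a > 0 \<longrightarrow> b < 0) \<and> (a < 0 \<longrightarrow> b > 0) \<and> (a = 0 \<longrightarrow> b = 0)"
    if "a * x + b * y = 0" "x < 0" "y < 0" for a b x y :: real
  proof -
    have "a * x = b * (- y)" "x < 0" "- y > 0" using that by auto
    then show ?thesis
      by (smt (verit, ccfv_SIG) mult_eq_0_iff mult_less_0_iff zero_less_mult_iff)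
  qed
  show False using opp[OF e(1)] opp[OF e(2)] opp[OF e(3)] z c(1) by linarith
qed

lemma edge_segment:
  assumes "polytope P" "e edge_of P"
  obtains i j where "i \<noteq> j" "e = closed_segment i j" "{v. v extreme_point_of P} \<inter> e = {i, j}"
proof -
  have e: "e face_of P" "aff_dim e = 1" using assms by (auto simp: edge_of_def)
  then have "polytope e" using assms face_of_polytope_polytope by blast
  moreover have "e \<noteq> {}" "collinear e" using e by (auto simp: collinear_aff_dim)
  ultimately obtain i j where ij: "e = closed_segment i j"
    using compact_convex_collinear_segment[of e] polytope_imp_compact polytope_imp_convex by blast
  have "i \<noteq> j" using e(2) ij by auto
  moreover have "{v. v extreme_point_of P} \<inter> e = {v. v extreme_point_of e}"
    using extreme_point_of_face[OF e(1)] by auto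
  ultimately show ?thesis using that ij by (auto simp: extreme_point_of_segment)
qed

context polytope3
begin

text \<open>For generic \<open>h\<close> and \<open>v\<close> neither lowest nor highest, the plane
  through \<open>v\<close> at constant height cuts \<open>P\<close> in a polygon with corner
  \<open>v\<close>; these are the facets carrying the two sides at that corner.\<close>

definition crossing :: "real^3 \<Rightarrow> real^3 \<Rightarrow> (real^3) set set" where
  "crossing h v = {\<sigma>\<in>F. v \<in> \<sigma> \<and> (\<exists>u\<in>V \<inter> \<sigma>. h \<bullet> u < h \<bullet> v) \<and> (\<exists>w\<in>V \<inter> \<sigma>. h \<bullet> v < h \<bullet> w)}"

lemma finite_crossing: "finite (crossing h v)"
  using finite_F by (simp add: crossing_def)

lemma collinear_vertices:
  assumes "u \<in> V" "v \<in> V" "w \<in> V" "collinear {u, v, w}" shows "u = v \<or> v = w \<or> u = w"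
proof (rule ccontr)
  assume ne: "\<not> ?thesis"
  have "between (v, w) u \<or> between (w, u) v \<or> between (u, v) w"
    using assms(4) by (simp add: collinear_between_cases)
  then show False
    using V_not_between[of v w u] V_not_between[of w u v] V_not_between[of u v w] assms VP ne
    by (auto simp: between_mem_segment closed_segment_eq_open)
qed

lemma three_vertices_two_facets:
  assumes "\<sigma> \<in> F" "\<tau> \<in> F" "{u, v, w} \<subseteq> V \<inter> \<sigma> \<inter> \<tau>" "u \<noteq> v" "v \<noteq> w" "u \<noteq> w"
  shows "\<sigma> = \<tau>"
proof (rule ccontr)
  assume "\<sigma> \<noteq> \<tau>"
  then have "collinear (\<sigma> \<inter> \<tau>)" using aff_dim_facets_Int assms by (simp add: collinear_aff_dim)
  then have "collinear {u, v, w}" using assms(3) collinear_subset by blast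
  then show False using collinear_vertices assms by auto
qed

text \<open>Each crossing facet contains a direction at \<open>v\<close> of constant height that is
  strictly inside the half-spaces of the other facets at \<open>v\<close>. Such directions are sides
  of a plane cone, and \<open>no_three_sides\<close> excludes three of them.\<close>

lemma card_crossing_le:
  assumes v: "v \<in> V" shows "card (crossing h v) \<le> 2"
proof (rule ccontr)
  assume "\<not> ?thesis"
  then have "3 \<le> card (crossing h v)" by simp
  then obtain D where D: "D \<subseteq> crossing h v" "card D = 3"
    by (meson obtain_subset_with_card_n)
  have "\<exists>x. h \<bullet> (x - v) = 0 \<and> x \<in> \<sigma> \<and> (\<forall>\<tau>\<in>F. v \<in> \<tau> \<and> \<tau> \<noteq> \<sigma> \<longrightarrow> N \<tau> \<bullet> x < 1)" if "\<sigma> \<in> D" for \<sigma>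
  proof -
    have cr: "\<sigma> \<in> crossing h v" using that D by blast
    then have \<sigma>: "\<sigma> \<in> F" "v \<in> \<sigma>" by (auto simp: crossing_def)
    obtain u w where uw: "u \<in> V \<inter> \<sigma>" "w \<in> V \<inter> \<sigma>" "h \<bullet> u < h \<bullet> v" "h \<bullet> v < h \<bullet> w"
      using cr unfolding crossing_def by blast
    \<comment> \<open>The parameter at which the segment from \<open>u\<close> to \<open>w\<close>
      reaches the height of \<open>v\<close>.\<close>
    define s where "s = (h \<bullet> v - h \<bullet> u) / (h \<bullet> w - h \<bullet> u)"
    have s: "0 < s" "s < 1" using uw by (auto simp: s_def)
    define x where "x = (1 - s) *\<^sub>R u + s *\<^sub>R w"
    have "s * (h \<bullet> w - h \<bullet> u) = h \<bullet> v - h \<bullet> u" using uw by (simp add: s_def)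
    then have "h \<bullet> (x - v) = 0" by (simp add: x_def inner_diff_right inner_add_right algebra_simps)
    moreover have x\<sigma>: "x \<in> \<sigma>"
      unfolding x_def using F_face[OF \<sigma>(1)] uw s face_of_imp_convex
      by (intro convexD_alt) auto
    \<comment> \<open>A face containing the inner point \<open>x\<close> of the segment contains
      \<open>u\<close> and \<open>w\<close> too, so \<open>\<sigma>\<close> and
      \<open>\<tau>\<close> would share three vertices.\<close>
    moreover have "N \<tau> \<bullet> x < 1" if \<tau>: "\<tau> \<in> F" "v \<in> \<tau>" "\<tau> \<noteq> \<sigma>" for \<tau>
    proof (rule ccontr)
      assume "\<not> ?thesis"
      moreover have "x \<in> P" using x\<sigma> mem_F[OF \<sigma>(1)] by simp
      ultimately have "x \<in> \<tau>" using N_le[OF \<tau>(1)] mem_F[OF \<tau>(1)] by force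
      moreover have "x \<in> open_segment u w" using s uw by (auto simp: x_def in_segment)
      ultimately have "u \<in> \<tau>" "w \<in> \<tau>"
        using face_ofD[OF F_face(1)[OF \<tau>(1)]] uw VP by blast+
      moreover have "v \<noteq> u" "v \<noteq> w" "u \<noteq> w" using uw by auto
      ultimately show False
        using three_vertices_two_facets[OF \<sigma>(1) \<tau>(1), of v u w] uw \<tau> \<sigma> v by auto
    qed
    ultimately show ?thesis by blast
  qed
  then obtain x where x: "\<And>\<sigma>. \<sigma> \<in> D \<Longrightarrow> h \<bullet> (x \<sigma> - v) = 0 \<and> x \<sigma> \<in> \<sigma> \<and>
      (\<forall>\<tau>\<in>F. v \<in> \<tau> \<and> \<tau> \<noteq> \<sigma> \<longrightarrow> N \<tau> \<bullet> x \<sigma> < 1)" by metis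
  have DF: "\<sigma> \<in> F \<and> v \<in> \<sigma>" if "\<sigma> \<in> D" for \<sigma> using that D by (auto simp: crossing_def)
  have "card D \<noteq> 3"
  proof (rule no_three_sides[where h = h and d = "\<lambda>\<sigma>. x \<sigma> - v" and n = N])
    have "D \<noteq> {}" using D by auto
    then show "h \<noteq> 0" using D(1) by (auto simp: crossing_def)
    show "h \<bullet> (x i - v) = 0" if "i \<in> D" for i using x that by auto
    show "N i \<bullet> (x i - v) = 0" if "i \<in> D" for i
      using x[OF that] DF[OF that] mem_F by (auto simp: inner_diff_right)
    show "N i \<bullet> (x j - v) < 0" if "i \<in> D" "j \<in> D" "i \<noteq> j" for i j
      using x[OF that(2)] DF[OF that(1)] that mem_F by (auto simp: inner_diff_right)
  qed
  then show False using D by simp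
qed

lemma facets_at_vertex: "v \<in> V \<Longrightarrow> {\<sigma>\<in>F. v \<in> \<sigma>} \<noteq> {}"
  using normals_span[of v "axis 1 1"] by (auto simp: axis_eq_0_iff)

lemma other_facets_at_vertex:
  assumes "v \<in> V" "\<sigma> \<in> F" "v \<in> \<sigma>" shows "{\<tau>\<in>F. v \<in> \<tau> \<and> \<tau> \<noteq> \<sigma>} \<noteq> {}"
proof
  assume e: "{\<tau>\<in>F. v \<in> \<tau> \<and> \<tau> \<noteq> \<sigma>} = {}"
  have "\<sigma> \<noteq> {v}" using F_face(2)[OF assms(2)] by auto
  then obtain w where w: "w \<in> \<sigma>" "w \<noteq> v" using assms by auto
  have "N \<sigma> \<bullet> (w - v) = 0" using mem_F assms w by (simp add: inner_diff_right)
  then have "w - v = 0" using e by (intro normals_span[OF assms(1)]) auto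
  then show False using w by simp
qed

text \<open>Otherwise the plane at the height of \<open>v\<close> supports \<open>\<sigma>\<close>
  and cuts out a face of \<open>P\<close>. By genericity its only vertex is \<open>v\<close>, so
  \<open>w\<close> could not lie on it.\<close>

lemma facet_vertex_above:
  assumes h: "inj_on (\<lambda>v. h \<bullet> v) V" and v: "v \<in> V" and \<sigma>: "\<sigma> \<in> F"
    and w: "w \<in> \<sigma>" "h \<bullet> w = h \<bullet> v" "w \<noteq> v"
  shows "\<exists>u\<in>V \<inter> \<sigma>. h \<bullet> v < h \<bullet> u"
proof (rule ccontr)
  assume "\<not> ?thesis"
  then have le: "V \<inter> \<sigma> \<subseteq> {x. h \<bullet> x \<le> h \<bullet> v}" by (auto simp: not_less)
  have "\<sigma> \<subseteq> {x. h \<bullet> x \<le> h \<bullet> v}"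
    using face_hull[OF F_face(1)[OF \<sigma>]] hull_minimal[where S = convex, OF le convex_halfspace_le] by simp
  then have f: "\<sigma> \<inter> {x. h \<bullet> x = h \<bullet> v} face_of \<sigma>"
    using F_face[OF \<sigma>] face_of_imp_convex by (intro face_of_Int_supporting_hyperplane_le) auto
  have "\<sigma> \<inter> {x. h \<bullet> x = h \<bullet> v} face_of P" using f F_face(1)[OF \<sigma>] face_of_trans by blast
  then have "\<sigma> \<inter> {x. h \<bullet> x = h \<bullet> v} = convex hull (V \<inter> (\<sigma> \<inter> {x. h \<bullet> x = h \<bullet> v}))" by (rule face_hull)
  also have "\<dots> \<subseteq> convex hull {v}" by (rule hull_mono) (use h v in \<open>auto simp: inj_on_def\<close>)
  finally show False using w by auto
qed

text \<open>The plane at the height of \<open>v\<close> meets the interior of \<open>P\<close>, so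
  \<open>two_sides\<close> applies to the section at \<open>v\<close>. Each side lies in a facet and
  has a second point at this height, to which \<open>facet_vertex_above\<close> is applied with
  \<open>h\<close> and with \<open>- h\<close>.\<close>

lemma card_crossing_ge:
  assumes h: "inj_on (\<lambda>v. h \<bullet> v) V" and v: "v \<in> V"
    and a: "a \<in> V" "h \<bullet> a < h \<bullet> v" and b: "b \<in> V" "h \<bullet> v < h \<bullet> b"
  shows "2 \<le> card (crossing h v)"
proof -
  have cl: "closure (interior P) = P"
    using convex_closure_interior[OF convP] zero compP by (auto simp: closure_closed compact_imp_closed)
  have "\<exists>y\<in>interior P. h \<bullet> y < h \<bullet> v"
    using a VP cl open_Int_closure_eq_empty[OF open_halfspace_lt[of h "h \<bullet> v"], of "interior P"] by auto
  moreover have "\<exists>y\<in>interior P. h \<bullet> v < h \<bullet> y"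
    using b VP cl open_Int_closure_eq_empty[OF open_halfspace_gt[of "h \<bullet> v" h], of "interior P"] by auto
  ultimately obtain x where x: "x \<in> interior P" "h \<bullet> x = h \<bullet> v"
    using connected_ivt_hyperplane[of "interior P" _ _ h "h \<bullet> v"] convP
    by (metis convex_connected convex_interior less_imp_le)
  let ?T = "{\<sigma>\<in>F. v \<in> \<sigma>}"
  obtain \<rho> \<tau> d d' where r: "\<rho> \<in> ?T" "\<tau> \<in> ?T" "\<rho> \<noteq> \<tau>" "h \<bullet> d = 0" "h \<bullet> d' = 0"
    "N \<rho> \<bullet> d = 0" "N \<tau> \<bullet> d' = 0" "d \<noteq> 0" "d' \<noteq> 0"
    "\<And>\<sigma>. \<sigma> \<in> ?T \<Longrightarrow> N \<sigma> \<bullet> d \<le> 0" "\<And>\<sigma>. \<sigma> \<in> ?T \<Longrightarrow> N \<sigma> \<bullet> d' \<le> 0"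
  proof (rule two_sides[where T = ?T and h = h and ?d0.0 = "x - v" and n = N])
    show "N \<sigma> \<bullet> (x - v) < 0" if "\<sigma> \<in> ?T" for \<sigma>
      using that N_lt_interior[OF x(1)] mem_F by (auto simp: inner_diff_right)
    show "d = 0" if "\<And>\<sigma>. \<sigma> \<in> ?T \<Longrightarrow> N \<sigma> \<bullet> d = 0" for d
      using normals_span[OF v] that by auto
  qed (use finite_F x facets_at_vertex v in \<open>auto simp: inner_diff_right\<close>)
  have cross: "\<rho> \<in> crossing h v"
    if r: "\<rho> \<in> ?T" "h \<bullet> d = 0" "N \<rho> \<bullet> d = 0" "d \<noteq> 0" "\<And>\<sigma>. \<sigma> \<in> ?T \<Longrightarrow> N \<sigma> \<bullet> d \<le> 0" for \<rho> d
  proof -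
    obtain e where e: "e > 0" "v + e *\<^sub>R d \<in> P" using feasible_direction[of v d] r VP v by auto
    let ?w = "v + e *\<^sub>R d"
    have w: "?w \<in> \<rho>" "h \<bullet> ?w = h \<bullet> v" "?w \<noteq> v"
      using r e mem_F by (auto simp: inner_add_right)
    have "inj_on (\<lambda>v. (- h) \<bullet> v) V" using h by (simp add: inj_on_def)
    then show ?thesis
      using facet_vertex_above[OF h v _ w] facet_vertex_above[of "- h" v \<rho> ?w] w r v
      by (auto simp: crossing_def)
  qed
  have "{\<rho>, \<tau>} \<subseteq> crossing h v" using cross r by auto
  then have "card {\<rho>, \<tau>} \<le> card (crossing h v)" by (intro card_mono finite_crossing)
  then show ?thesis using r by simp
qed

end

section \<open>Counting incidences\<close>

context polytope3
begin

definition "incidences A B = {(v, \<sigma>). v \<in> A \<and> \<sigma> \<in> B \<and> v \<in> \<sigma>}"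

lemma finite_incidences: "finite A \<Longrightarrow> finite B \<Longrightarrow> finite (incidences A B)"
  by (rule finite_subset[of _ "A \<times> B"]) (auto simp: incidences_def)

lemma card_incidences_vertices:
  assumes "finite A" "finite B" shows "card (incidences A B) = (\<Sum>v\<in>A. card {\<sigma>\<in>B. v \<in> \<sigma>})"
proof -
  have "incidences A B = (SIGMA v:A. {\<sigma>\<in>B. v \<in> \<sigma>})" by (auto simp: incidences_def)
  then show ?thesis using assms by simp
qed

lemma card_incidences_facets:
  assumes "finite A" "finite B" shows "card (incidences A B) = (\<Sum>\<sigma>\<in>B. card {v\<in>A. v \<in> \<sigma>})"
proof -
  have "incidences A B = prod.swap ` (SIGMA \<sigma>:B. {v\<in>A. v \<in> \<sigma>})"
    by (force simp: incidences_def image_iff)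
  then show ?thesis using assms by (simp add: card_image)
qed

text \<open>Taken relative to \<open>A\<close>, as the sub-families in \<open>min_degree\<close>
  require. With \<open>- h\<close> in place of \<open>h\<close> it gives the highest
  vertices.\<close>

definition "lowest h A B = {(v, \<sigma>) \<in> incidences A B. \<forall>u\<in>A \<inter> \<sigma>. h \<bullet> v \<le> h \<bullet> u}"

lemma inj_on_lowest:
  assumes "inj_on (\<lambda>v. h \<bullet> v) V" "A \<subseteq> V" shows "inj_on snd (lowest h A B)"
proof (rule inj_onI, clarsimp simp: lowest_def incidences_def)
  fix u v \<sigma> assume "u \<in> A" "v \<in> A" "u \<in> \<sigma>" "v \<in> \<sigma>"
    "\<forall>w\<in>A \<inter> \<sigma>. h \<bullet> u \<le> h \<bullet> w" "\<forall>w\<in>A \<inter> \<sigma>. h \<bullet> v \<le> h \<bullet> w"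
  then have "h \<bullet> u = h \<bullet> v" "u \<in> V" "v \<in> V" using assms by (force intro: antisym)+
  then show "u = v" using assms(1) by (auto simp: inj_on_def)
qed

lemma card_lowest_le:
  assumes "inj_on (\<lambda>v. h \<bullet> v) V" "A \<subseteq> V" "finite B" shows "card (lowest h A B) \<le> card B"
  by (rule card_inj_on_le[OF inj_on_lowest[OF assms(1,2)]])
     (use assms in \<open>auto simp: lowest_def incidences_def\<close>)

lemma facet_vertices_nonempty: "\<sigma> \<in> F \<Longrightarrow> V \<inter> \<sigma> \<noteq> {}"
  using face_hull[OF F_face(1), of \<sigma>] F_face(2)[of \<sigma>] by auto

lemma card_lowest_ge: "card F \<le> card (lowest h V F)"
proof -
  have "F \<subseteq> snd ` lowest h V F"
  proof
    fix \<sigma> assume \<sigma>: "\<sigma> \<in> F"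
    obtain v where "v \<in> V \<inter> \<sigma>" "\<And>u. u \<in> V \<inter> \<sigma> \<Longrightarrow> h \<bullet> v \<le> h \<bullet> u"
      using ex_is_arg_min_if_finite[of "V \<inter> \<sigma>" "\<lambda>v. h \<bullet> v"] finite_V facet_vertices_nonempty[OF \<sigma>]
      by (auto simp: is_arg_min_linorder)
    then have "(v, \<sigma>) \<in> lowest h V F" using \<sigma> by (auto simp: lowest_def incidences_def)
    then show "\<sigma> \<in> snd ` lowest h V F" by force
  qed
  moreover have "finite (lowest h V F)"
    by (rule finite_subset[OF _ finite_incidences[OF finite_V finite_F]]) (auto simp: lowest_def)
  ultimately show ?thesis by (rule surj_card_le[rotated])
qed

text \<open>
  Each facet has one lowest and one highest vertex; an incidence that is neither is a crossing,
  and the bottom vertex has no crossings.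
\<close>

lemma card_incidences_le:
  assumes A: "A \<subseteq> V" "A \<noteq> {}" and B: "B \<subseteq> F"
  shows "card (incidences A B) + 2 \<le> 2 * card A + 2 * card B"
proof -
  have fin: "finite A" "finite B" using A B finite_V finite_F finite_subset by auto
  obtain h where h: "inj_on (\<lambda>v. h \<bullet> v) V" using exists_generic_direction[OF finite_V] .
  then have h': "inj_on (\<lambda>v. (- h) \<bullet> v) V" by (simp add: inj_on_def)
  obtain v0 where v0: "v0 \<in> A" "\<And>u. u \<in> A \<Longrightarrow> h \<bullet> v0 \<le> h \<bullet> u"
    using ex_is_arg_min_if_finite[of A "\<lambda>v. h \<bullet> v"] fin A by (auto simp: is_arg_min_linorder)
  define M where "M = (SIGMA v:A - {v0}. crossing h v)"
  have "incidences A B \<subseteq> lowest h A B \<union> lowest (- h) A B \<union> M"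
  proof
    fix p assume p: "p \<in> incidences A B"
    obtain v \<sigma> where [simp]: "p = (v, \<sigma>)" by force
    have v: "v \<in> A" "\<sigma> \<in> B" "v \<in> \<sigma>" using p by (auto simp: incidences_def)
    show "p \<in> lowest h A B \<union> lowest (- h) A B \<union> M"
    proof (rule ccontr)
      assume n: "p \<notin> lowest h A B \<union> lowest (- h) A B \<union> M"
      then obtain u w where "u \<in> A \<inter> \<sigma>" "h \<bullet> u < h \<bullet> v" "w \<in> A \<inter> \<sigma>" "h \<bullet> v < h \<bullet> w"
        using p by (auto simp: lowest_def not_le)
      then have "\<sigma> \<in> crossing h v" "v \<noteq> v0"
        using v v0 A B by (auto simp: crossing_def not_le[symmetric])
      then show False using n v by (auto simp: M_def)
    qed
  qed
  moreover have "finite (lowest h A B)" "finite (lowest (- h) A B)" "finite M"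
    using fin finite_incidences[OF fin]
    by (auto simp: lowest_def M_def finite_crossing intro: finite_subset[of _ "incidences A B"])
  ultimately have "card (incidences A B) \<le> card (lowest h A B \<union> lowest (- h) A B \<union> M)"
    by (intro card_mono) auto
  also have "\<dots> \<le> card (lowest h A B) + card (lowest (- h) A B) + card M"
    by (meson add_le_mono card_Un_le le_refl le_trans)
  also have "card M \<le> (\<Sum>v\<in>A - {v0}. 2)"
    unfolding M_def using fin finite_crossing card_crossing_le A
    by (subst card_SigmaI) (auto intro!: sum_mono simp del: sum_constant)
  finally have "card (incidences A B) \<le> card (lowest h A B) + card (lowest (- h) A B) + 2 * (card A - 1)"
    using fin v0 by (simp add: mult.commute)
  moreover have "card A > 0" using fin v0 by (auto simp: card_gt_0_iff)
  ultimately show ?thesis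
    using card_lowest_le[OF h A(1) fin(2)] card_lowest_le[OF h' A(1) fin(2)] by linarith
qed

text \<open>If all degrees were at least 4, counting the incidences from both sides would give at
  least \<open>2 * card A + 2 * card B\<close> of them, above the sweep bound.\<close>

lemma min_degree:
  assumes A: "A \<subseteq> V" and B: "B \<subseteq> F" and ne: "A \<noteq> {} \<or> B \<noteq> {}"
  shows "(\<exists>v\<in>A. card {\<sigma>\<in>B. v \<in> \<sigma>} \<le> 3) \<or> (\<exists>\<sigma>\<in>B. card {v\<in>A. v \<in> \<sigma>} \<le> 3)"
proof (rule ccontr)
  assume "\<not> ?thesis"
  then have n: "\<And>v. v \<in> A \<Longrightarrow> 4 \<le> card {\<sigma>\<in>B. v \<in> \<sigma>}" "\<And>\<sigma>. \<sigma> \<in> B \<Longrightarrow> 4 \<le> card {v\<in>A. v \<in> \<sigma>}"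
    by (auto simp: not_le)
  have fin: "finite A" "finite B" using A B finite_V finite_F finite_subset by auto
  have "A \<noteq> {}" using ne n(2) by fastforce
  then have "card (incidences A B) + 2 \<le> 2 * card A + 2 * card B" using A B card_incidences_le by auto
  moreover have "4 * card A \<le> card (incidences A B)"
    unfolding card_incidences_vertices[OF fin] using sum_mono[of A "\<lambda>_. 4", OF n(1), simplified] by (simp add: mult.commute)
  moreover have "4 * card B \<le> card (incidences A B)"
    unfolding card_incidences_facets[OF fin] using sum_mono[of B "\<lambda>_. 4", OF n(2), simplified] by (simp add: mult.commute)
  ultimately show False by linarith
qed

lemma facet_vertices_ge_2:
  assumes "\<sigma> \<in> F" shows "\<exists>u\<in>V \<inter> \<sigma>. u \<noteq> v"
proof (rule ccontr)
  assume "\<not> ?thesis"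
  then have "V \<inter> \<sigma> \<subseteq> {v}" by auto
  then have "\<sigma> \<subseteq> convex hull {v}" using face_hull[OF F_face(1)[OF assms]] hull_mono by metis
  then have "aff_dim \<sigma> \<le> aff_dim {v}" by (metis aff_dim_subset convex_hull_singleton)
  then show False using F_face assms by simp
qed

text \<open>Each facet contributes a lowest and a different highest vertex, and every vertex except
  the bottom and the top one has at least two crossings. These two exceptions account for the
  4.\<close>

lemma card_incidences_ge: "2 * card V + 2 * card F \<le> card (incidences V F) + 4"
proof -
  obtain h where h: "inj_on (\<lambda>v. h \<bullet> v) V" using exists_generic_direction[OF finite_V] .
  have ne: "V \<noteq> {}" using P_hull zero interior_subset by fastforce
  obtain v0 where v0: "v0 \<in> V" "\<And>u. u \<in> V \<Longrightarrow> h \<bullet> v0 \<le> h \<bullet> u"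
    using ex_is_arg_min_if_finite[of V "\<lambda>v. h \<bullet> v"] finite_V ne by (auto simp: is_arg_min_linorder)
  obtain v1 where v1: "v1 \<in> V" "\<And>u. u \<in> V \<Longrightarrow> h \<bullet> u \<le> h \<bullet> v1"
    using ex_is_arg_min_if_finite[of V "\<lambda>v. - (h \<bullet> v)"] finite_V ne by (auto simp: is_arg_min_linorder)
  define M where "M = (SIGMA v:V - {v0, v1}. crossing h v)"
  have sub: "lowest h V F \<union> lowest (- h) V F \<union> M \<subseteq> incidences V F"
    by (auto simp: lowest_def M_def incidences_def crossing_def)
  have fin: "finite (incidences V F)" by (intro finite_incidences finite_V finite_F)
  have "lowest h V F \<inter> lowest (- h) V F = {}"
  proof (auto simp: lowest_def incidences_def)
    fix v \<sigma> assume *: "v \<in> V" "\<sigma> \<in> F" "v \<in> \<sigma>" "\<forall>u\<in>V \<inter> \<sigma>. h \<bullet> v \<le> h \<bullet> u" "\<forall>u\<in>V \<inter> \<sigma>. h \<bullet> u \<le> h \<bullet> v"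
    obtain u where "u \<in> V \<inter> \<sigma>" "u \<noteq> v" using facet_vertices_ge_2[OF *(2)] by blast
    then show False using * h by (force simp: inj_on_def)
  qed
  moreover have "(lowest h V F \<union> lowest (- h) V F) \<inter> M = {}"
    by (auto simp: lowest_def M_def crossing_def not_le[symmetric])
  ultimately have "card (lowest h V F) + card (lowest (- h) V F) + card M =
      card (lowest h V F \<union> lowest (- h) V F \<union> M)"
    using finite_subset[OF sub fin] by (simp add: card_Un_disjoint)
  also have "\<dots> \<le> card (incidences V F)" using sub fin by (rule card_mono[rotated])
  finally have le: "card (lowest h V F) + card (lowest (- h) V F) + card M \<le> card (incidences V F)" .
  have "(\<Sum>v\<in>V - {v0, v1}. 2) \<le> card M"
  proof -
    have "(\<Sum>v\<in>V - {v0, v1}. 2) \<le> (\<Sum>v\<in>V - {v0, v1}. card (crossing h v))"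
    proof (rule sum_mono)
      fix v assume v: "v \<in> V - {v0, v1}"
      then have "h \<bullet> v0 < h \<bullet> v" "h \<bullet> v < h \<bullet> v1"
        using v0(2)[of v] v1(2)[of v] inj_onD[OF h, of v v0] inj_onD[OF h, of v v1] v0(1) v1(1)
        by (auto simp: order_le_less)
      then show "2 \<le> card (crossing h v)" using card_crossing_ge[OF h] v v0 v1 by auto
    qed
    then show ?thesis unfolding M_def using finite_V finite_crossing by simp
  qed
  moreover have "card V \<le> card (V - {v0, v1}) + 2"
  proof -
    have "card V - card {v0, v1} \<le> card (V - {v0, v1})" by (rule diff_card_le_card_Diff) simp
    moreover have "card {v0, v1} \<le> 2" by (simp add: card_insert_if)
    ultimately show ?thesis by linarith
  qed
  ultimately show ?thesis using le card_lowest_ge[of h] card_lowest_ge[of "- h"] by simp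
qed

section \<open>Edges as intersections of facets, and flags\<close>

definition "E = Edges (polytope_type P)"

lemma E_eq: "e \<in> E \<longleftrightarrow> (\<exists>i j. e = {i, j} \<and> closed_segment i j edge_of P)"
  by (auto simp: E_def polytope_type_def)

lemma E_pair: "e \<in> E \<Longrightarrow> \<exists>i j. e = {i, j} \<and> i \<noteq> j \<and> i \<in> V \<and> j \<in> V"
  unfolding E_eq V_def using segment_face_of by (fastforce simp: edge_of_def)

lemma finite_E: "finite E"
proof (rule finite_subset)
  show "E \<subseteq> Pow V" using E_pair by blast
qed (simp add: finite_V)

lemma facets_Int_edge:
  assumes "\<sigma> \<in> F" "\<tau> \<in> F" "\<sigma> \<noteq> \<tau>" "v \<in> \<sigma> \<inter> \<tau>" "w \<in> \<sigma> \<inter> \<tau>" "w \<noteq> v"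
  shows "V \<inter> (\<sigma> \<inter> \<tau>) \<in> E"
proof -
  have "aff_dim {v, w} \<le> aff_dim (\<sigma> \<inter> \<tau>)" using assms by (intro aff_dim_subset) auto
  then have "aff_dim (\<sigma> \<inter> \<tau>) = 1" using aff_dim_facets_Int[of \<sigma> \<tau>] assms by (simp add: aff_dim_2)
  then have "\<sigma> \<inter> \<tau> edge_of P"
    using assms by (auto simp: edge_of_def intro: face_of_Int F_face)
  then show ?thesis
    using edge_segment[OF poly] unfolding E_eq V_def by metis
qed

text \<open>Count flags: each incidence has two edges along it, each edge two end points and two facets.\<close>

lemma card_incidences_edges: "card (incidences V F) \<le> 2 * card E"
proof -
  \<comment> \<open>\<open>G (v, \<sigma>)\<close> collects the facets sharing with
    \<open>\<sigma>\<close> an edge at \<open>v\<close>, so an element of \<open>Y\<close> is an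
    edge with a chosen end point and an ordered pair of facets through it.\<close>
  define G where "G = (\<lambda>(v, \<sigma>). {\<tau>\<in>F. \<tau> \<noteq> \<sigma> \<and> v \<in> \<tau> \<and> (\<exists>w\<in>\<sigma> \<inter> \<tau>. w \<noteq> v)})"
  define Y where "Y = Sigma (incidences V F) G"
  have finG: "finite (G p)" for p using finite_F by (auto simp: G_def split: prod.split)
  have fin: "finite (incidences V F)" by (intro finite_incidences finite_V finite_F)
  have "2 \<le> card (G p)" if p: "p \<in> incidences V F" for p
  proof -
    obtain v \<sigma> where [simp]: "p = (v, \<sigma>)" by force
    have v: "v \<in> V" "\<sigma> \<in> F" "v \<in> \<sigma>" using p by (auto simp: incidences_def)
    obtain x where x: "x \<in> rel_interior \<sigma>"
      using F_face[OF v(2)] v(3) rel_interior_eq_empty face_of_imp_convex by blast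
    have x\<sigma>: "x \<in> \<sigma>" using x rel_interior_subset by blast
    let ?T = "{\<tau>\<in>F. v \<in> \<tau> \<and> \<tau> \<noteq> \<sigma>}"
    have neg: "N \<tau> \<bullet> (x - v) < 0" if \<tau>: "\<tau> \<in> ?T" for \<tau>
    proof -
      have "\<sigma> \<inter> \<tau> face_of P" using \<tau> v by (simp add: face_of_Int F_face)
      then have "\<sigma> \<inter> \<tau> face_of \<sigma>" using face_of_face[OF F_face(1)[OF v(2)]] by simp
      moreover have "\<sigma> \<inter> \<tau> \<noteq> \<sigma>"
      proof
        assume "\<sigma> \<inter> \<tau> = \<sigma>"
        then have "V \<inter> \<sigma> \<subseteq> \<tau>" by auto
        then show False using facet_subset_eq[OF v(2)] \<tau> by auto
      qed
      ultimately have "x \<notin> \<tau>" using face_of_disjoint_rel_interior[of "\<sigma> \<inter> \<tau>" \<sigma>] x x\<sigma> by auto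
      moreover have "x \<in> P" using x\<sigma> mem_F v by auto
      ultimately have "N \<tau> \<bullet> x < 1" using N_le[of \<tau> x] mem_F[of \<tau> x] \<tau> by auto
      then show ?thesis using \<tau> mem_F[of \<tau> v] by (simp add: inner_diff_right)
    qed
    have pointed: "d = 0" if "N \<sigma> \<bullet> d = 0" "\<And>\<tau>. \<tau> \<in> ?T \<Longrightarrow> N \<tau> \<bullet> d = 0" for d
    proof (rule normals_span[OF v(1)])
      show "N \<tau> \<bullet> d = 0" if "\<tau> \<in> F" "v \<in> \<tau>" for \<tau>
        using that \<open>N \<sigma> \<bullet> d = 0\<close> \<open>\<And>\<tau>. \<tau> \<in> ?T \<Longrightarrow> N \<tau> \<bullet> d = 0\<close>[of \<tau>] by (cases "\<tau> = \<sigma>") auto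
    qed
    \<comment> \<open>\<open>two_sides\<close> is used inside the plane of \<open>\<sigma>\<close>,
      with \<open>N \<sigma>\<close> as \<open>h\<close> and the other facets at \<open>v\<close> as
      constraints: the two sides are the directions of the edges of \<open>\<sigma>\<close> at
      \<open>v\<close>.\<close>
    obtain \<rho> \<tau> d d' where r: "\<rho> \<in> ?T" "\<tau> \<in> ?T" "\<rho> \<noteq> \<tau>" "N \<sigma> \<bullet> d = 0" "N \<sigma> \<bullet> d' = 0"
      "N \<rho> \<bullet> d = 0" "N \<tau> \<bullet> d' = 0" "d \<noteq> 0" "d' \<noteq> 0"
      "\<And>\<sigma>. \<sigma> \<in> ?T \<Longrightarrow> N \<sigma> \<bullet> d \<le> 0" "\<And>\<sigma>. \<sigma> \<in> ?T \<Longrightarrow> N \<sigma> \<bullet> d' \<le> 0"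
    proof (rule two_sides[where T = ?T and h = "N \<sigma>" and ?d0.0 = "x - v" and n = N])
      show "N \<sigma> \<bullet> (x - v) = 0" using x\<sigma> v mem_F by (simp add: inner_diff_right)
      show "finite ?T" using finite_F by simp
      show "?T \<noteq> {}" by (rule other_facets_at_vertex[OF v])
      show "d = 0" if "N \<sigma> \<bullet> d = 0" "\<And>\<tau>. \<tau> \<in> ?T \<Longrightarrow> N \<tau> \<bullet> d = 0" for d
        using that by (rule pointed)
      show "N \<tau> \<bullet> (x - v) < 0" if "\<tau> \<in> ?T" for \<tau>
        using that by (rule neg)
    qed (rule that)
    have *: "\<rho> \<in> G p"
      if r: "\<rho> \<in> ?T" "N \<sigma> \<bullet> d = 0" "N \<rho> \<bullet> d = 0" "d \<noteq> 0" "\<And>\<sigma>. \<sigma> \<in> ?T \<Longrightarrow> N \<sigma> \<bullet> d \<le> 0" for \<rho> d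
    proof -
      obtain e where e: "e > 0" "v + e *\<^sub>R d \<in> P"
      proof (rule feasible_direction[of v d])
        show "N \<tau> \<bullet> d \<le> 0" if "\<tau> \<in> F" "v \<in> \<tau>" for \<tau>
          using that r(2) r(5)[of \<tau>] by (cases "\<tau> = \<sigma>") auto
      qed (use VP v in auto)
      have \<rho>: "\<rho> \<in> F" "v \<in> \<rho>" "\<rho> \<noteq> \<sigma>" using r(1) by auto
      have "v + e *\<^sub>R d \<in> \<sigma> \<inter> \<rho>" "v + e *\<^sub>R d \<noteq> v"
        using e r(2-4) v \<rho> by (auto simp: mem_F inner_add_right)
      then have "\<exists>w\<in>\<sigma> \<inter> \<rho>. w \<noteq> v" by blast
      then show ?thesis using \<rho> by (simp add: G_def)
    qed
    have "{\<rho>, \<tau>} \<subseteq> G p"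
      using *[OF r(1) r(4) r(6) r(8) r(10)] *[OF r(2) r(5) r(7) r(9) r(11)] by simp
    then have "card {\<rho>, \<tau>} \<le> card (G p)" by (intro card_mono finG)
    then show ?thesis using r(3) by simp
  qed
  then have "2 * card (incidences V F) \<le> card Y"
    unfolding Y_def using sum_mono[of "incidences V F" "\<lambda>_. 2" "\<lambda>p. card (G p)"] fin finG
    by simp
  also have "card Y \<le> 4 * card E"
  proof -
    \<comment> \<open>At most two facets contain both end points of \<open>e\<close>, hence at most
      two ordered pairs; the choice of an end point doubles this to 4.\<close>
    define H where "H = (\<lambda>e. {(\<sigma>, \<tau>). \<sigma> \<in> F \<and> \<tau> \<in> F \<and> \<sigma> \<noteq> \<tau> \<and> e \<subseteq> \<sigma> \<and> e \<subseteq> \<tau>})"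
    define Z where "Z = (SIGMA e:E. e \<times> H e)"
    have finH: "finite (H e)" for e
      by (rule finite_subset[of _ "F \<times> F"]) (auto simp: H_def finite_F)
    have cardZ: "card (e \<times> H e) \<le> 4" if e: "e \<in> E" for e
    proof -
      obtain i j where ij: "e = {i, j}" "i \<noteq> j" "i \<in> V" "j \<in> V" using E_pair[OF e] by blast
      let ?S = "{\<sigma>\<in>F. i \<in> \<sigma> \<and> j \<in> \<sigma>}"
      have S: "card ?S \<le> 2" "finite ?S" using edge_two_facets ij finite_F by auto
      have "H e = ?S \<times> ?S - (\<lambda>\<sigma>. (\<sigma>, \<sigma>)) ` ?S" using ij by (auto simp: H_def)
      then have "card (H e) = card ?S * card ?S - card ?S"
        using S by (simp add: card_Diff_subset image_subset_iff card_image inj_on_def card_cartesian_product)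
      also have "\<dots> \<le> 2" using S(1) by (auto simp: le_Suc_eq numeral_2_eq_2)
      finally show ?thesis using ij by (simp add: card_cartesian_product)
    qed
    have finZ: "finite Z"
      unfolding Z_def using finite_E finH E_pair by (intro finite_SigmaI) (auto dest: E_pair)
    define f where "f = (\<lambda>((v :: real^3, \<sigma> :: (real^3) set), \<tau> :: (real^3) set). (V \<inter> (\<sigma> \<inter> \<tau>), v, \<sigma>, \<tau>))"
    have "f ` Y \<subseteq> Z"
      using facets_Int_edge by (force simp: f_def Y_def Z_def G_def H_def incidences_def)
    moreover have "inj_on f Y" by (auto simp: inj_on_def f_def)
    ultimately have "card Y \<le> card Z" using card_inj_on_le finZ by blast
    also have "card Z \<le> (\<Sum>e\<in>E. 4)"
      unfolding Z_def using cardZ finite_E finH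
      by (subst card_SigmaI) (auto intro!: sum_mono dest: E_pair simp del: sum_constant)
    finally show ?thesis by simp
  qed
  finally show ?thesis by simp
qed

end

section \<open>Coordinates from eliminating elements of low degree\<close>

text \<open>By spanning and compactness, the sum \<open>\<phi>\<close> of absolute pairings has a
  positive minimum on the unit sphere. If all \<open>g k\<close> annihilated a unit vector,
  \<open>\<phi>\<close> there would be at most the total perturbation.\<close>

lemma perturbed_spanning_family:
  fixes f :: "'k \<Rightarrow> 'a::euclidean_space"
  assumes fin: "finite K" and span: "span (f ` K) = UNIV"
  obtains \<epsilon> where "\<epsilon> > 0"
    "\<And>g d. \<lbrakk>\<And>k. k \<in> K \<Longrightarrow> dist (g k) (f k) < \<epsilon>; \<And>k. k \<in> K \<Longrightarrow> g k \<bullet> d = 0\<rbrakk> \<Longrightarrow> d = 0"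
proof -
  define \<phi> where "\<phi> = (\<lambda>d. \<Sum>k\<in>K. \<bar>f k \<bullet> d\<bar>)"
  have "continuous_on (sphere 0 1) \<phi>" unfolding \<phi>_def by (intro continuous_intros)
  moreover obtain b0 :: 'a where "b0 \<in> Basis" using nonempty_Basis by blast
  then have "sphere 0 1 \<noteq> ({} :: 'a set)" by (force simp: norm_Basis)
  ultimately obtain u where u: "norm u = 1" "\<And>d. norm d = 1 \<Longrightarrow> \<phi> u \<le> \<phi> d"
    using continuous_attains_inf[of "sphere 0 1" \<phi>] by auto
  have "\<phi> u > 0"
  proof (rule ccontr)
    assume "\<not> \<phi> u > 0"
    moreover have "\<phi> u \<ge> 0" by (auto simp: \<phi>_def intro: sum_nonneg)
    ultimately have "\<phi> u = 0" by simp
    then have "\<forall>k\<in>K. orthogonal u (f k)"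
      using fin by (simp add: \<phi>_def sum_nonneg_eq_0_iff orthogonal_def inner_commute)
    then have "orthogonal u u" using span by (intro orthogonal_to_span[of u "f ` K"]) auto
    then show False using u by (auto simp: orthogonal_self)
  qed
  show ?thesis
  proof
    \<comment> \<open>The \<open>+ 1\<close> keeps the sum of \<open>card K\<close> errors strictly
      below the minimum \<open>\<phi> u\<close>.\<close>
    show "\<phi> u / (card K + 1) > 0" using \<open>\<phi> u > 0\<close> by (simp add: add_nonneg_pos)
    fix g d assume g: "\<And>k. k \<in> K \<Longrightarrow> dist (g k) (f k) < \<phi> u / (card K + 1)" "\<And>k. k \<in> K \<Longrightarrow> g k \<bullet> d = 0"
    show "d = 0"
    proof (rule ccontr)
      assume d: "d \<noteq> 0"
      have "\<phi> u \<le> \<phi> (d /\<^sub>R norm d)" using d by (intro u(2)) simp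
      also have "\<dots> = (\<Sum>k\<in>K. \<bar>f k \<bullet> (d /\<^sub>R norm d)\<bar>)" unfolding \<phi>_def ..
      also have "\<dots> \<le> (\<Sum>k\<in>K. \<phi> u / (card K + 1))"
      proof (rule sum_mono)
        fix k assume k: "k \<in> K"
        have "\<bar>f k \<bullet> (d /\<^sub>R norm d)\<bar> = \<bar>(f k - g k) \<bullet> (d /\<^sub>R norm d)\<bar>"
          using g(2)[OF k] by (simp add: inner_diff_left)
        also have "\<dots> \<le> norm (f k - g k) * norm (d /\<^sub>R norm d)" by (rule Cauchy_Schwarz_ineq2)
        also have "\<dots> = dist (g k) (f k)" using d by (simp add: dist_norm norm_minus_commute)
        finally show "\<bar>f k \<bullet> (d /\<^sub>R norm d)\<bar> \<le> \<phi> u / (card K + 1)" using g(1)[OF k] by simp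
      qed
      also have "\<dots> = card K * \<phi> u / (card K + 1)" by simp
      also have "\<dots> < \<phi> u" using \<open>\<phi> u > 0\<close> by (simp add: field_simps add_nonneg_pos)
      finally show False by simp
    qed
  qed
qed

text \<open>
  Remove an element of degree at most 3: given the others, its position is fixed by independent
  linear equations, which are completed to a basis by constant functionals.
\<close>

definition determines ::
  "('i \<Rightarrow> 'i \<Rightarrow> bool) \<Rightarrow> ('i \<Rightarrow> real^3) \<Rightarrow> 'i set \<Rightarrow> ('i \<times> (real^3)) set \<Rightarrow> real \<Rightarrow> bool" where
  "determines adj z0 B C \<epsilon> \<longleftrightarrow> (\<forall>z z'. (\<forall>n\<in>B. dist (z n) (z0 n) < \<epsilon>) \<longrightarrow>
      (\<forall>m\<in>B. \<forall>n\<in>B. adj m n \<longrightarrow> z m \<bullet> z n = 1 \<and> z' m \<bullet> z' n = 1) \<longrightarrow>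
      (\<forall>(n, b)\<in>C. z n \<bullet> b = z' n \<bullet> b) \<longrightarrow> (\<forall>n\<in>B. z n = z' n))"

text \<open>Removing \<open>n\<close> with neighbours \<open>D\<close> contributes
  \<open>3 - card D\<close> coordinates and \<open>2 * card D\<close> ordered adjacent pairs, hence
  6 to the count. Only \<open>z\<close> has to be near \<open>z0\<close>: when \<open>n\<close> is
  placed, \<open>z\<close> and \<open>z'\<close> already agree on its neighbours, so
  \<open>z n\<close> and \<open>z' n\<close> satisfy the same linear conditions.\<close>

lemma local_coordinates:
  fixes z0 :: "'i \<Rightarrow> real^3"
  assumes "finite B" and sym: "\<And>m n. adj m n \<longleftrightarrow> adj n m" and irrefl: "\<And>n. \<not> adj n n"
    and deg: "\<And>A. A \<subseteq> B \<Longrightarrow> A \<noteq> {} \<Longrightarrow> \<exists>n\<in>A. card {m\<in>A. adj m n} \<le> 3"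
    and ind: "\<And>n D. n \<in> B \<Longrightarrow> D \<subseteq> {m\<in>B. adj m n} \<Longrightarrow> card D \<le> 3 \<Longrightarrow>
      inj_on z0 D \<and> independent (z0 ` D)"
  shows "\<exists>C. finite C \<and> fst ` C \<subseteq> B \<and> 2 * card C + card {(m, n) \<in> B \<times> B. adj m n} = 6 * card B \<and>
    (\<exists>\<epsilon>>0. determines adj z0 B C \<epsilon>)"
  using assms(1) deg ind
proof (induction "card B" arbitrary: B rule: nat_less_induct)
  case 1
  note finB = \<open>finite B\<close>
  note deg = 1(3) and ind = 1(4)
  show ?case
  proof (cases "B = {}")
    case True
    then show ?thesis
      by (intro exI[of _ "{}"]) (auto simp: determines_def intro!: exI[of _ "1::real"])
  next
    case False
    obtain n where n: "n \<in> B" "card {m\<in>B. adj m n} \<le> 3" using deg[OF subset_refl False] by blast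
    define D where "D = {m\<in>B. adj m n}"
    define B' where "B' = B - {n}"
    have B': "card B' < card B" "finite B'" "B' \<subseteq> B"
      using card_Diff1_less[OF finB n(1)] finB by (simp_all only: B'_def) auto
    have D: "D \<subseteq> B'" "finite D" using irrefl finB by (auto simp: D_def B'_def)
    have IH: "\<exists>C. finite C \<and> fst ` C \<subseteq> B' \<and>
        2 * card C + card {(m, n) \<in> B' \<times> B'. adj m n} = 6 * card B' \<and>
        (\<exists>\<epsilon>>0. determines adj z0 B' C \<epsilon>)"
    proof (rule 1(1)[rule_format, OF B'(1) refl B'(2)])
      show "\<exists>n\<in>A. card {m \<in> A. adj m n} \<le> 3" if "A \<subseteq> B'" "A \<noteq> {}" for A
        using deg[of A] that B'(3) by blast
      show "inj_on z0 D \<and> independent (z0 ` D)" if "n \<in> B'" "D \<subseteq> {m\<in>B'. adj m n}" "card D \<le> 3" for n D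
        using ind[of n D] that B'(3) by blast
    qed
    then obtain C \<epsilon> where C: "finite C" "fst ` C \<subseteq> B'"
        "2 * card C + card {(m, n) \<in> B' \<times> B'. adj m n} = 6 * card B'"
      and \<epsilon>: "\<epsilon> > 0" "determines adj z0 B' C \<epsilon>" by blast
    have D': "inj_on z0 D" "independent (z0 ` D)" using ind[OF n(1), of D] n(2) by (auto simp: D_def)
    obtain T where T: "z0 ` D \<subseteq> T" "independent T" "UNIV \<subseteq> span T"
      using maximal_independent_subset_extend[OF subset_UNIV D'(2)] by metis
    have cT: "finite T" "card T = 3"
      using independent_bound[OF T(2)] basis_card_eq_dim[OF subset_UNIV T(3) T(2)] by simp_all
    define X where "X = T - z0 ` D"
    have X: "finite X" "card X + card D = 3"
      using cT D(2) card_mono[OF cT(1) T(1)] card_image[OF D'(1)]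
      by (simp_all add: X_def card_Diff_subset T(1))
    \<comment> \<open>The functionals tested on the position of \<open>n\<close>: the positions of
      its neighbours, which vary with \<open>z\<close>, and the fixed vectors completing them to a
      basis at \<open>z0\<close>.\<close>
    define f where "f = (\<lambda>z. case_sum z (\<lambda>b. b) :: 'i + real^3 \<Rightarrow> real^3)"
    have "f z0 ` (D <+> X) = T" using T(1) by (auto simp: f_def X_def Plus_def image_Un image_image)
    then have "span (f z0 ` (D <+> X)) = UNIV" using T(3) by auto
    moreover have "finite (D <+> X)" using D X by simp
    ultimately obtain \<delta> where \<delta>: "\<delta> > 0"
      "\<And>g d. \<lbrakk>\<And>k. k \<in> D <+> X \<Longrightarrow> dist (g k) (f z0 k) < \<delta>; \<And>k. k \<in> D <+> X \<Longrightarrow> g k \<bullet> d = 0\<rbrakk> \<Longrightarrow> d = 0"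
      using perturbed_spanning_family by blast
    define C' where "C' = C \<union> {n} \<times> X"
    have disj: "C \<inter> {n} \<times> X = {}" using C(2) by (force simp: B'_def)
    have cC': "card C' = card C + card X"
      unfolding C'_def using disj C(1) X by (simp add: card_Un_disjoint card_cartesian_product)
    have "{(m, n) \<in> B \<times> B. adj m n} = {(m, n) \<in> B' \<times> B'. adj m n} \<union> (D \<times> {n} \<union> {n} \<times> D)"
      using n irrefl by (auto simp: B'_def D_def sym)
    moreover have "finite {(m, n) \<in> B' \<times> B'. adj m n}"
      by (rule finite_subset[of _ "B' \<times> B'"]) (use B' in auto)
    moreover have "{(m, n) \<in> B' \<times> B'. adj m n} \<inter> (D \<times> {n} \<union> {n} \<times> D) = {}" by (auto simp: B'_def)
    moreover have "D \<times> {n} \<inter> {n} \<times> D = {}" using D by (auto simp: B'_def)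
    ultimately have cJ: "card {(m, n) \<in> B \<times> B. adj m n} =
        card {(m, n) \<in> B' \<times> B'. adj m n} + 2 * card D"
      using D(2) by (simp add: card_Un_disjoint card_cartesian_product)
    have cB: "card B = card B' + 1" using card.remove[OF finB n(1)] by (simp add: B'_def)
    have det: "\<forall>k\<in>B. z k = z' k"
      if near: "\<forall>n\<in>B. dist (z n) (z0 n) < min \<epsilon> \<delta>"
        and eqs: "\<forall>m\<in>B. \<forall>n\<in>B. adj m n \<longrightarrow> z m \<bullet> z n = 1 \<and> z' m \<bullet> z' n = 1"
        and coord: "\<forall>(n, b)\<in>C'. z n \<bullet> b = z' n \<bullet> b" for z z'
    proof -
      have "\<forall>k\<in>B'. z k = z' k"
      proof (rule \<epsilon>(2)[unfolded determines_def, THEN spec, THEN spec, THEN mp, THEN mp, THEN mp])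
        show "\<forall>n\<in>B'. dist (z n) (z0 n) < \<epsilon>" using near B'(3) by auto
        show "\<forall>m\<in>B'. \<forall>n\<in>B'. adj m n \<longrightarrow> z m \<bullet> z n = 1 \<and> z' m \<bullet> z' n = 1"
          using eqs B'(3) by blast
        show "\<forall>(n, b)\<in>C. z n \<bullet> b = z' n \<bullet> b" using coord by (auto simp: C'_def)
      qed
      moreover have "z n - z' n = 0"
      proof (rule \<delta>(2)[of "f z"])
        show "dist (f z k) (f z0 k) < \<delta>" if "k \<in> D <+> X" for k
        proof (cases k)
          case (Inl m)
          then have "m \<in> B" using that D(1) B'(3) by auto
          then show ?thesis using near Inl by (simp add: f_def)
        qed (simp add: f_def \<delta>(1))
        show "f z k \<bullet> (z n - z' n) = 0" if "k \<in> D <+> X" for k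
        proof (cases k)
          case (Inl m)
          then have m: "m \<in> D" using that by auto
          then have "m \<in> B" "adj m n" by (auto simp: D_def)
          then have "z m \<bullet> z n = 1" "z' m \<bullet> z' n = 1" using eqs n(1) by blast+
          moreover have "z m = z' m" using m D(1) \<open>\<forall>k\<in>B'. z k = z' k\<close> by blast
          ultimately show ?thesis using Inl by (simp add: f_def inner_diff_right)
        next
          case (Inr b)
          then have "(n, b) \<in> C'" using that by (auto simp: C'_def)
          then have "z n \<bullet> b = z' n \<bullet> b" using coord by blast
          then show ?thesis using Inr by (simp add: f_def inner_diff_right inner_commute)
        qed
      qed
      ultimately show ?thesis by (auto simp: B'_def)
    qed
    have "determines adj z0 B C' (min \<epsilon> \<delta>)"
      unfolding determines_def by (intro allI impI) (rule det)
    moreover have "min \<epsilon> \<delta> > 0" using \<epsilon> \<delta> by simp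
    moreover have "finite C'" "fst ` C' \<subseteq> B" using C X n by (auto simp: C'_def B'_def)
    moreover have "2 * card C' + card {(m, n) \<in> B \<times> B. adj m n} = 6 * card B"
      using cC' cJ cB C(3) X(2) by linarith
    ultimately show ?thesis by blast
  qed
qed

section \<open>Rotations and isometries\<close>

text \<open>The rotation given by the unnormalised quaternion \<open>1 + u\<close>.\<close>

definition rot :: "real^3 \<Rightarrow> real^3 \<Rightarrow> real^3" where
  "rot u x = ((1 - u \<bullet> u) *\<^sub>R x + (2 * (u \<bullet> x)) *\<^sub>R u + 2 *\<^sub>R cross3 u x) /\<^sub>R (1 + u \<bullet> u)"

lemma rot_denominator_pos: "1 + u \<bullet> u > (0::real)" for u :: "real^3"
  by (simp add: add_pos_nonneg)

lemma linear_rot: "linear (rot u)"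
  unfolding rot_def
  by (rule linearI) (simp_all add: cross_add_right cross_mult_right algebra_simps inner_add_right)

lemma rot_adjoint: "rot u x \<bullet> y = x \<bullet> rot (- u) y"
proof -
  have "cross3 u x \<bullet> y = - (x \<bullet> cross3 u y)"
    by (simp add: cross3_def inner_vec_def sum_3 algebra_simps)
  then show ?thesis
    unfolding rot_def by (simp add: inner_add_left inner_add_right inner_commute algebra_simps)
qed

text \<open>\<open>1 - u\<close> is the conjugate of the quaternion \<open>1 + u\<close>, whose
  squared norm is \<open>1 + q\<close>. Without the denominators the composition therefore scales
  \<open>x\<close> by \<open>(1 + q) * (1 + q)\<close>.\<close>

lemma rot_inverse: "rot (- u) (rot u x) = x"
proof -
  define q where "q = u \<bullet> u"
  define w where "w = (1 - q) *\<^sub>R x + (2 * (u \<bullet> x)) *\<^sub>R u + 2 *\<^sub>R cross3 u x"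
  have q: "1 + q > 0" by (simp add: q_def rot_denominator_pos)
  have cc: "cross3 u (cross3 u x) = (u \<bullet> x) *\<^sub>R u - q *\<^sub>R x"
    by (simp add: q_def Lagrange)
  have uw: "u \<bullet> w = (1 + q) * (u \<bullet> x)"
    by (simp add: w_def inner_add_right dot_cross_self q_def algebra_simps)
  have cw: "cross3 u w = (1 - q) *\<^sub>R cross3 u x + 2 *\<^sub>R ((u \<bullet> x) *\<^sub>R u - q *\<^sub>R x)"
    unfolding w_def by (simp add: cross_add_right cross_mult_right cc)
  have "(1 - q) *\<^sub>R w + (2 * (u \<bullet> w)) *\<^sub>R u - 2 *\<^sub>R cross3 u w = ((1 + q) * (1 + q)) *\<^sub>R x"
    unfolding uw cw by (simp add: w_def vec_eq_iff algebra_simps)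
  moreover have "rot (- u) w = ((1 - q) *\<^sub>R w + (2 * (u \<bullet> w)) *\<^sub>R u - 2 *\<^sub>R cross3 u w) /\<^sub>R (1 + q)"
    by (simp add: rot_def q_def cross_minus_left)
  moreover have "rot u x = w /\<^sub>R (1 + q)" by (simp add: rot_def w_def q_def)
  then have "rot (- u) (rot u x) = rot (- u) w /\<^sub>R (1 + q)" by (simp add: linear_scale[OF linear_rot])
  moreover have "inverse (1 + q) * (inverse (1 + q) * ((1 + q) * (1 + q))) = 1"
  proof -
    have "inverse s * (inverse s * (s * s)) = 1" if "s \<noteq> 0" for s :: real
      using that by (simp add: field_simps)
    then show ?thesis using q by force
  qed
  ultimately show ?thesis by simp
qed

lemma inner_rot: "rot u x \<bullet> rot u y = x \<bullet> y"
  by (simp add: rot_adjoint rot_inverse)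

lemma rot_diff: "rot u (x - y) = rot u x - rot u y"
  using linear_diff[OF linear_rot] .

lemma dist_rot: "dist (rot u x) (rot u y) = dist x y"
  by (simp add: dist_norm norm_eq_sqrt_inner inner_rot flip: rot_diff)

lemma rot_inj: "rot u x = rot u y \<Longrightarrow> x = y"
  by (metis rot_inverse)

text \<open>The trace gives \<open>u \<bullet> u\<close>, after which the antisymmetric part, a
  known multiple of \<open>u\<close>, gives \<open>u\<close>.\<close>

lemma rot_eq_imp_eq:
  assumes "\<And>x. rot u x = rot v x" shows "u = v"
proof -
  have e: "\<And>i j. rot u (axis i 1) $ j = rot v (axis i 1) $ j" using assms by simp
  let ?q = "\<lambda>u :: real^3. u \<bullet> u"
  have tr: "rot u (axis 1 1) $ 1 + rot u (axis 2 1) $ 2 + rot u (axis 3 1) $ 3 = 4 / (1 + ?q u) - 1" for u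
  proof -
    have "rot u (axis 1 1) $ 1 + rot u (axis 2 1) $ 2 + rot u (axis 3 1) $ 3 = (3 - ?q u) / (1 + ?q u)"
      by (simp add: rot_def cross3_def inner_axis axis_def divide_inverse)
         (simp add: inner_vec_def sum_3 algebra_simps)
    also have "\<dots> = 4 / (1 + ?q u) - 1" using rot_denominator_pos[of u] by (simp add: field_simps)
    finally show ?thesis .
  qed
  have "4 / (1 + ?q u) = 4 / (1 + ?q v)" using tr[of u] tr[of v] e by simp
  then have q: "?q u = ?q v" using rot_denominator_pos[of u] rot_denominator_pos[of v] by (simp add: field_simps)
  have anti: "rot u (axis 1 1) $ 2 - rot u (axis 2 1) $ 1 = 4 * u $ 3 / (1 + ?q u)"
    "rot u (axis 2 1) $ 3 - rot u (axis 3 1) $ 2 = 4 * u $ 1 / (1 + ?q u)"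
    "rot u (axis 3 1) $ 1 - rot u (axis 1 1) $ 3 = 4 * u $ 2 / (1 + ?q u)" for u
    by (simp_all add: rot_def cross3_def inner_axis axis_def divide_inverse algebra_simps)
       (simp_all add: inner_vec_def sum_3)
  have "u $ 1 = v $ 1" "u $ 2 = v $ 2" "u $ 3 = v $ 3"
    using anti[of u] anti[of v] e q rot_denominator_pos[of v] by (auto simp: field_simps)
  then show ?thesis by (simp add: vec_eq_iff forall_3)
qed

lemma continuous_on_rot [continuous_intros]:
  assumes "continuous_on S f" "continuous_on S g"
  shows "continuous_on S (\<lambda>x. rot (f x) (g x))"
proof -
  have "1 + u \<bullet> u \<noteq> 0" for u :: "real^3" using rot_denominator_pos[of u] by simp
  then have "continuous_on UNIV (\<lambda>p. rot (fst p) (snd p))"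
    unfolding rot_def by (auto intro!: continuous_intros continuous_on_cross)
  from continuous_on_compose2[OF this continuous_on_Pair[OF assms]] show ?thesis by simp
qed

text \<open>By polarisation the distances determine all inner products of differences. A basis among
  the differences defines \<open>B\<close>, which may reverse orientation.\<close>

lemma congruent_families_isometry:
  fixes p :: "'a::euclidean_space \<Rightarrow> 'a"
  assumes v0: "v0 \<in> V" and span: "span ((\<lambda>v. v - v0) ` V) = UNIV"
    and dist: "\<And>v w. v \<in> V \<Longrightarrow> w \<in> V \<Longrightarrow> dist (p v) (p w) = dist v w"
  obtains B c where "orthogonal_transformation B" "\<And>v. v \<in> V \<Longrightarrow> p v = B v + c"
proof -
  have polar: "x \<bullet> y = ((norm x)\<^sup>2 + (norm y)\<^sup>2 - (norm (x - y))\<^sup>2) / 2" for x y :: 'a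
    by (simp add: power2_norm_eq_inner inner_diff inner_commute)
  have gram: "(p v - p v0) \<bullet> (p w - p v0) = (v - v0) \<bullet> (w - v0)" if "v \<in> V" "w \<in> V" for v w
    using dist[OF that] dist[OF that(1) v0] dist[OF that(2) v0]
    unfolding polar by (simp add: dist_norm)
  obtain T where T: "T \<subseteq> (\<lambda>v. v - v0) ` V" "independent T" "span T = UNIV"
    using maximal_independent_subset[of "(\<lambda>v. v - v0) ` V"] span
    by (metis span_span span_mono top.extremum_unique)
  define f where "f = (\<lambda>x. p (x + v0) - p v0)"
  obtain B where B: "linear B" "\<And>x. x \<in> T \<Longrightarrow> B x = f x"
    using linear_independent_extend[OF T(2), of f] by blast
  have TV: "x + v0 \<in> V" if "x \<in> T" for x using that T(1) by auto
  have Bf: "B x \<bullet> (p w - p v0) = x \<bullet> (w - v0)" if w: "w \<in> V" for x w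
  proof -
    have "linear (\<lambda>x. B x \<bullet> (p w - p v0))" "linear (\<lambda>x. x \<bullet> (w - v0))"
      using B(1) by (auto intro!: linearI simp: inner_add_left linear_add linear_scale)
    moreover have "B x \<bullet> (p w - p v0) = x \<bullet> (w - v0)" if "x \<in> T" for x
      using gram[OF TV[OF that] w] B(2)[OF that] by (simp add: f_def)
    ultimately show ?thesis using linear_eq_on_span[of _ _ T x] T(3) by auto
  qed
  have BB: "B x \<bullet> B y = x \<bullet> y" for x y
  proof -
    have "linear (\<lambda>y. B x \<bullet> B y)" "linear (\<lambda>y. x \<bullet> y)"
      using B(1) by (auto intro!: linearI simp: inner_add_right linear_add linear_scale)
    moreover have "B x \<bullet> B y = x \<bullet> y" if "y \<in> T" for y
      using Bf[OF TV[OF that], of x] B(2)[OF that] by (simp add: f_def)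
    ultimately show ?thesis using linear_eq_on_span[of _ _ T y] T(3) by auto
  qed
  then have orth: "orthogonal_transformation B" using B(1) by (simp add: orthogonal_transformation_def)
  have "p v = B v + (p v0 - B v0)" if v: "v \<in> V" for v
  proof -
    \<comment> \<open>The defect at a point outside the chosen basis: it is orthogonal to the whole
      image of \<open>B\<close>, hence 0.\<close>
    define d where "d = p v - p v0 - B (v - v0)"
    have "B x \<bullet> d = 0" for x
      using Bf[OF v, of x] BB[of x "v - v0"] by (simp add: d_def inner_diff_right)
    moreover obtain x where "d = B x"
      using orthogonal_transformation_surj[OF orth] by (metis surjD)
    ultimately have "d = 0" by (metis inner_eq_zero_iff)
    then show ?thesis using linear_diff[OF B(1), of v v0] by (simp add: d_def algebra_simps)
  qed
  then show ?thesis using that orth by blast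
qed

section \<open>Coordinates of a polytope\<close>

definition adjacent :: "real^3 + (real^3) set \<Rightarrow> real^3 + (real^3) set \<Rightarrow> bool" where
  "adjacent m n = (case (m, n) of (Inl v, Inr \<sigma>) \<Rightarrow> v \<in> \<sigma> | (Inr \<sigma>, Inl v) \<Rightarrow> v \<in> \<sigma> | _ \<Rightarrow> False)"

lemma adjacent_simps [simp]:
  "adjacent (Inl v) (Inr \<sigma>) \<longleftrightarrow> v \<in> \<sigma>" "adjacent (Inr \<sigma>) (Inl v) \<longleftrightarrow> v \<in> \<sigma>"
  "\<not> adjacent (Inl v) (Inl w)" "\<not> adjacent (Inr \<sigma>) (Inr \<tau>)"
  by (simp_all add: adjacent_def)

lemma adjacent_Inl_iff: "adjacent m (Inl v) \<longleftrightarrow> (\<exists>\<sigma>. m = Inr \<sigma> \<and> v \<in> \<sigma>)"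
  by (cases m) auto

lemma adjacent_Inr_iff: "adjacent m (Inr \<sigma>) \<longleftrightarrow> (\<exists>v. m = Inl v \<and> v \<in> \<sigma>)"
  by (cases m) auto

lemma adjacent_sym: "adjacent m n \<longleftrightarrow> adjacent n m"
  by (cases m; cases n) auto

lemma adjacent_irrefl: "\<not> adjacent n n"
  by (cases n) auto

context polytope3
begin

text \<open>Vertices and normals form one family because the elimination treats both kinds
  alike.\<close>

definition z0 :: "real^3 + (real^3) set \<Rightarrow> real^3" where
  "z0 = case_sum (\<lambda>v. v) N"

lemma z0_simps [simp]: "z0 (Inl v) = v" "z0 (Inr \<sigma>) = N \<sigma>"
  by (simp_all add: z0_def)

lemma card_adjacent: "card {(m, n) \<in> (V <+> F) \<times> (V <+> F). adjacent m n} = 2 * card (incidences V F)"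
proof -
  define f where "f = (\<lambda>(v :: real^3, \<sigma> :: (real^3) set).
    (Inl v, Inr \<sigma>) :: (real^3 + (real^3) set) \<times> (real^3 + (real^3) set))"
  define g where "g = (\<lambda>(v :: real^3, \<sigma> :: (real^3) set).
    (Inr \<sigma>, Inl v) :: (real^3 + (real^3) set) \<times> (real^3 + (real^3) set))"
  let ?I = "incidences V F"
  have "{(m, n) \<in> (V <+> F) \<times> (V <+> F). adjacent m n} = f ` ?I \<union> g ` ?I"
    by (auto simp: incidences_def image_iff f_def g_def)
  moreover have "f ` ?I \<inter> g ` ?I = {}" by (auto simp: f_def g_def)
  moreover have "card (f ` ?I) = card ?I" "card (g ` ?I) = card ?I"
    by (auto intro!: card_image simp: inj_on_def f_def g_def)
  moreover have "finite ?I" by (intro finite_incidences finite_V finite_F)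
  ultimately show ?thesis by (simp add: card_Un_disjoint)
qed

text \<open>With \<open>I\<close> incidences, elimination leaves
  \<open>3 * (card V + card F) - I\<close> coordinates. The sweep bounds
  \<open>card V + card F\<close> by \<open>I / 2 + 2\<close>, so at most \<open>I / 2 + 6\<close>
  remain, and the flag count bounds \<open>I / 2\<close> by \<open>card E\<close>.\<close>

lemma polytope_coordinates:
  obtains C \<epsilon> where "finite C" "fst ` C \<subseteq> V <+> F" "card C \<le> card E + 6" "\<epsilon> > 0"
    "determines adjacent z0 (V <+> F) C \<epsilon>"
proof -
  have "\<exists>C. finite C \<and> fst ` C \<subseteq> V <+> F \<and>
      2 * card C + card {(m, n) \<in> (V <+> F) \<times> (V <+> F). adjacent m n} = 6 * card (V <+> F) \<and>
      (\<exists>\<epsilon>>0. determines adjacent z0 (V <+> F) C \<epsilon>)"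
  proof (rule local_coordinates)
    show "finite (V <+> F)" using finite_V finite_F by simp
    show "adjacent m n = adjacent n m" for m n by (rule adjacent_sym)
    show "\<not> adjacent n n" for n by (rule adjacent_irrefl)
  next
    fix A assume A: "A \<subseteq> V <+> F" "A \<noteq> {}"
    let ?V = "Inl -` A" and ?F = "Inr -` A"
    have "?V \<subseteq> V" "?F \<subseteq> F" using A(1) by auto
    moreover have "?V \<noteq> {} \<or> ?F \<noteq> {}"
    proof -
      obtain x where "x \<in> A" using A(2) by blast
      then show ?thesis by (cases x) auto
    qed
    ultimately consider v where "Inl v \<in> A" "card {\<sigma>\<in>?F. v \<in> \<sigma>} \<le> 3"
      | \<sigma> where "Inr \<sigma> \<in> A" "card {v\<in>?V. v \<in> \<sigma>} \<le> 3"
      using min_degree[of ?V ?F] by auto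
    then show "\<exists>n\<in>A. card {m\<in>A. adjacent m n} \<le> 3"
    proof cases
      case 1
      have "{m\<in>A. adjacent m (Inl v)} = Inr ` {\<sigma>\<in>?F. v \<in> \<sigma>}"
        by (auto simp: adjacent_Inl_iff)
      then show ?thesis using 1 by (intro bexI[of _ "Inl v"]) (auto simp: card_image)
    next
      case 2
      have "{m\<in>A. adjacent m (Inr \<sigma>)} = Inl ` {v\<in>?V. v \<in> \<sigma>}"
        by (auto simp: adjacent_Inr_iff)
      then show ?thesis using 2 by (intro bexI[of _ "Inr \<sigma>"]) (auto simp: card_image)
    qed
  next
    fix n D assume n: "n \<in> V <+> F" "D \<subseteq> {m \<in> V <+> F. adjacent m n}" "card D \<le> 3"
    show "inj_on z0 D \<and> independent (z0 ` D)"
    proof (cases n)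
      case (Inl v)
      let ?D = "Inr -` D"
      have D: "D = Inr ` ?D" "?D \<subseteq> {\<sigma>\<in>F. v \<in> \<sigma>}"
        using n(2) Inl by (auto simp: adjacent_Inl_iff)
      then have "card ?D \<le> 3" using n(3) by (metis card_image inj_Inr subset_UNIV inj_on_subset)
      then have "inj_on N ?D" "independent (N ` ?D)"
        using independent_normals[of v ?D] D(2) n(1) Inl by auto
      moreover have "z0 ` D = N ` ?D"
        using arg_cong[where f = "image z0", OF D(1)] by (simp only: image_image z0_simps)
      moreover have "inj_on z0 D"
      proof (rule inj_onI)
        fix x y assume xy: "x \<in> D" "y \<in> D" "z0 x = z0 y"
        then obtain \<sigma> \<tau> where *: "x = Inr \<sigma>" "y = Inr \<tau>" using D(1) by blast
        then have "\<sigma> = \<tau>" using xy by (intro inj_onD[OF \<open>inj_on N ?D\<close>]) auto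
        then show "x = y" using * by simp
      qed
      ultimately show ?thesis by simp
    next
      case (Inr \<sigma>)
      let ?D = "Inl -` D"
      have D: "D = Inl ` ?D" "?D \<subseteq> V \<inter> \<sigma>"
        using n(2) Inr by (auto simp: adjacent_Inr_iff)
      then have "card ?D \<le> 3" using n(3) by (metis card_image inj_Inl subset_UNIV inj_on_subset)
      then have "independent ?D"
        using independent_vertices[of \<sigma> ?D] D(2) n(1) Inr by auto
      moreover have "z0 ` D = ?D"
        using arg_cong[where f = "image z0", OF D(1)] by (simp only: image_image z0_simps image_ident)
      moreover have "inj_on z0 D" by (subst D(1)) (auto simp: inj_on_def)
      ultimately show ?thesis by simp
    qed
  qed
  then obtain C where C: "finite C" "fst ` C \<subseteq> V <+> F" "\<exists>\<epsilon>>0. determines adjacent z0 (V <+> F) C \<epsilon>"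
    "2 * card C + 2 * card (incidences V F) = 6 * card (V <+> F)"
    unfolding card_adjacent by blast
  have "card (V <+> F) = card V + card F" using finite_V finite_F by (simp add: card_Plus)
  then have "card C \<le> card E + 6"
    using C(4) card_incidences_ge card_incidences_edges by linarith
  then show ?thesis using that C by blast
qed

section \<open>Spanning properties of the vertices\<close>

lemma span_vertices:
  assumes "v \<in> V" shows "span ((\<lambda>w. w - v) ` V) = UNIV"
proof -
  have "aff_dim V = 3" using dim3 P_hull by (metis aff_dim_convex_hull)
  then have "dim ((\<lambda>w. w - v) ` V) = DIM(real^3)"
    using aff_dim_eq_dim_subtract[of v V] assms hull_inc[of v V affine] by simp
  then show ?thesis using dim_eq_full by metis
qed

lemma V_nonempty: "V \<noteq> {}"
  using P_hull zero interior_subset by fastforce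

text \<open>The vertices of \<open>\<sigma>\<close> affinely span its plane, which misses the
  origin, so a linear functional vanishing on them is 0.\<close>

lemma facet_vertices_span:
  assumes \<sigma>: "\<sigma> \<in> F" and d: "\<And>v. v \<in> V \<inter> \<sigma> \<Longrightarrow> d \<bullet> v = 0" shows "d = 0"
proof (rule ccontr)
  assume "d \<noteq> 0"
  have "\<sigma> \<subseteq> {x. d \<bullet> x = 0}"
    using face_hull[OF F_face(1)[OF \<sigma>]] hull_minimal[where S = convex, OF _ convex_hyperplane, of "V \<inter> \<sigma>" d 0] d
    by auto
  then have *: "affine hull \<sigma> \<subseteq> {x. d \<bullet> x = 0}" by (rule hull_minimal) (rule affine_hyperplane)
  have "affine hull \<sigma> = {x. N \<sigma> \<bullet> x = 1}"
  proof (rule affine_dim_equal)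
    show "affine hull \<sigma> \<subseteq> {x. N \<sigma> \<bullet> x = 1}"
      by (rule hull_minimal) (use mem_F[OF \<sigma>] in \<open>auto simp: affine_hyperplane\<close>)
    have nz: "N \<sigma> \<noteq> 0" using mem_F[OF \<sigma>] facet_vertices_nonempty[OF \<sigma>] by force
    show "aff_dim (affine hull \<sigma>) = aff_dim {x. N \<sigma> \<bullet> x = 1}"
      using F_face(2)[OF \<sigma>] nz by simp
    show "affine hull \<sigma> \<noteq> {}" using facet_vertices_nonempty[OF \<sigma>] by auto
  qed (auto simp: affine_hyperplane)
  then have h: "d \<bullet> x = 0" if "N \<sigma> \<bullet> x = 1" for x using * that by auto
  obtain v where "N \<sigma> \<bullet> v = 1" using facet_vertices_nonempty[OF \<sigma>] mem_F[OF \<sigma>] by auto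
  \<comment> \<open>Either \<open>v + d\<close> is a further point of the plane, or a multiple of
    \<open>d\<close> lies on it; both give \<open>d \<bullet> d = 0\<close>.\<close>
  show False
  proof (cases "N \<sigma> \<bullet> d = 0")
    case True
    have "d \<bullet> (v + d) = 0" by (rule h) (simp add: inner_add_right True \<open>N \<sigma> \<bullet> v = 1\<close>)
    moreover have "d \<bullet> v = 0" by (rule h) fact
    ultimately show False using \<open>d \<noteq> 0\<close> by (simp add: inner_add_right)
  next
    case False
    then have "d \<bullet> (d /\<^sub>R (N \<sigma> \<bullet> d)) = 0" by (intro h) simp
    then show False using False \<open>d \<noteq> 0\<close> by simp
  qed
qed

lemma edge_length_map_cong:
  assumes "\<And>i j. {i, j} \<in> E \<Longrightarrow> dist (fst x i) (fst x j) = dist (fst y i) (fst y j)"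
  shows "edge_length_map (polytope_type P) x = edge_length_map (polytope_type P) y"
proof
  fix e
  show "edge_length_map (polytope_type P) x e = edge_length_map (polytope_type P) y e"
  proof (cases "e \<in> E")
    case True
    then obtain i j where e: "e = {i, j}" using E_pair by blast
    then have "{i, j} \<in> Edges (polytope_type P)" using True by (simp add: E_def)
    then show ?thesis
      using assms[of i j] True unfolding e by (simp add: edge_length_map_edge dist_norm E_def)
  qed (simp add: edge_length_map_def E_def)
qed

end

section \<open>Local rigidity\<close>

lemma rot_zero [simp]: "rot 0 x = x"
  by (simp add: rot_def)

text \<open>Differences eliminate the translations and leave two rotations agreeing on a spanning
  family. Passing to the adjoints \<open>rot (- u)\<close> and \<open>rot (- u')\<close> brings this
  into the form tested by \<open>span\<close>.\<close>

lemma rigid_motion_unique: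
  assumes span: "\<And>d. (\<And>v. v \<in> V \<Longrightarrow> (p v - p v0) \<bullet> d = 0) \<Longrightarrow> d = 0" and v0: "v0 \<in> V"
    and eq: "\<And>v. v \<in> V \<Longrightarrow> rot u (p v + t) = rot u' (p v + t')"
  shows "u = u' \<and> t = t'"
proof -
  have diff: "rot u (p v - p v0) = rot u' (p v - p v0)" if "v \<in> V" for v
  proof -
    have "rot u (p v - p v0) = rot u (p v + t) - rot u (p v0 + t)" by (simp flip: rot_diff)
    also have "\<dots> = rot u' (p v + t') - rot u' (p v0 + t')" using eq that v0 by simp
    finally show ?thesis by (simp flip: rot_diff)
  qed
  have "rot (- u) e = rot (- u') e" for e
  proof -
    have "rot (- u) e - rot (- u') e = 0"
    proof (rule span)
      fix v assume "v \<in> V"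
      then show "(p v - p v0) \<bullet> (rot (- u) e - rot (- u') e) = 0"
        using diff[of v] by (simp add: inner_diff_right flip: rot_adjoint)
    qed
    then show ?thesis by simp
  qed
  then have "- u = - u'" by (rule rot_eq_imp_eq)
  then have "u = u'" by simp
  moreover have "p v0 + t = p v0 + t'" using eq[OF v0] \<open>u = u'\<close> rot_inj by blast
  ultimately show ?thesis by simp
qed

context polytope3
begin

abbreviation "T \<equiv> polytope_type P"

lemma Verts_T: "Verts T = V" and Facets_T: "Facets T = F" and Edges_T: "Edges T = E"
  by (simp_all add: polytope_type_def V_def F_def E_def)

lemma incident_T: "incident T v \<sigma> \<longleftrightarrow> v \<in> \<sigma>"
  by (simp add: polytope_type_def)

lemma fst_config: "v \<in> V \<Longrightarrow> fst (polytope_config P) v = v"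
  and snd_config: "\<sigma> \<in> F \<Longrightarrow> snd (polytope_config P) \<sigma> = N \<sigma>"
  by (simp_all add: polytope_config_def Verts_T Facets_T N_def)

lemma REAL_incident: "(p, a) \<in> REAL T \<Longrightarrow> v \<in> V \<Longrightarrow> \<sigma> \<in> F \<Longrightarrow> v \<in> \<sigma> \<Longrightarrow> p v \<bullet> a \<sigma> = 1"
  by (simp add: REAL_def Verts_T Facets_T incident_T)

lemma dist_config: "{i, j} \<in> E \<Longrightarrow> dist (fst (polytope_config P) i) (fst (polytope_config P) j) = dist i j"
  using E_pair[of "{i, j}"] by (metis fst_config doubleton_eq_iff)

text \<open>These equations persist when a translation is followed by rescaling the normals,
  whatever the sign of the factor.\<close>

definition incidence_eqs :: "(real^3 + (real^3) set \<Rightarrow> real^3) \<Rightarrow> bool" where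
  "incidence_eqs z \<longleftrightarrow> (\<forall>v\<in>V. \<forall>\<sigma>\<in>F. v \<in> \<sigma> \<longrightarrow> z (Inl v) \<bullet> z (Inr \<sigma>) = 1)"

lemma incidence_eqsD:
  "incidence_eqs z \<Longrightarrow> m \<in> V <+> F \<Longrightarrow> n \<in> V <+> F \<Longrightarrow> adjacent m n \<Longrightarrow> z m \<bullet> z n = 1"
  by (auto simp: incidence_eqs_def inner_commute)

lemma local_rigidity:
  assumes "edge_length_perturbations_realizable T (polytope_config P)"
  shows "\<forall>\<^sub>F z in nhds z0. incidence_eqs z \<longrightarrow>
    (\<forall>i j. {i, j} \<in> E \<longrightarrow> dist (z (Inl i)) (z (Inl j)) = dist i j) \<longrightarrow>
    (\<forall>i\<in>V. \<forall>j\<in>V. dist (z (Inl i)) (z (Inl j)) = dist i j)"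
proof -
  note InlI [simp] InrI [simp]
  define L where "L = edge_length_space T"
  define l0 where "l0 = edge_length_map T (polytope_config P)"
  obtain \<psi> W where \<psi>: "continuous_on L \<psi>" "\<psi> ` L \<subseteq> REAL T" "\<psi> l0 = polytope_config P"
    and W: "openin (top_of_set L) W" "l0 \<in> W" "\<And>y. y \<in> W \<Longrightarrow> edge_length_map T (\<psi> y) = y"
    using assms unfolding edge_length_perturbations_realizable_def L_def l0_def by blast
  obtain G where G: "open G" "W = L \<inter> G" using W(1) by (meson openin_open)
  obtain C \<epsilon> where C: "finite C" "fst ` C \<subseteq> V <+> F" "card C \<le> card E + 6"
    and \<epsilon>: "\<epsilon> > 0" "determines adjacent z0 (V <+> F) C \<epsilon>"
    using polytope_coordinates by blast
  obtain v0 where v0: "v0 \<in> V" using V_nonempty by blast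
  \<comment> \<open>Near \<open>P\<close> the differences of vertices still span, which is what
    recovering the rigid motion requires.\<close>
  obtain \<delta> where \<delta>: "\<delta> > 0" "\<And>g d. \<lbrakk>\<And>v. v \<in> V \<Longrightarrow> dist (g v) (v - v0) < \<delta>;
      \<And>v. v \<in> V \<Longrightarrow> g v \<bullet> d = 0\<rbrakk> \<Longrightarrow> d = 0"
    using perturbed_spanning_family[OF finite_V span_vertices[OF v0]] by blast
  define k where "k = card E"
  define n where "n = k + 6"
  define S where "S = topspace (Euclidean_space n)"
  obtain idx where idx: "bij_betw idx E {0..<k}"
    using ex_bij_betw_finite_nat[OF finite_E] unfolding k_def by blast
  obtain c where c: "bij_betw c {0..<card C} C"
    using ex_bij_betw_nat_finite[OF C(1)] by blast
  \<comment> \<open>A parameter \<open>w\<close> consists of \<open>k\<close> edge lengths, three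
    rotation coordinates \<open>u w\<close> and three translation coordinates
    \<open>t w\<close>.\<close>
  define X where "X = (\<lambda>(w :: nat \<Rightarrow> real) e. if e \<in> E then w (idx e) else undefined)"
  define u where "u = (\<lambda>w :: nat \<Rightarrow> real. \<chi> i :: 3. if i = 1 then w k else if i = 2 then w (k + 1) else w (k + 2))"
  define t where "t = (\<lambda>w :: nat \<Rightarrow> real. \<chi> i :: 3. if i = 1 then w (k + 3) else if i = 2 then w (k + 4) else w (k + 5))"
  define p where "p = (\<lambda>w. fst (\<psi> (X w)))"
  define a where "a = (\<lambda>w. snd (\<psi> (X w)))"
  \<comment> \<open>After translation by \<open>t w\<close> an incident vertex pairs with the normal
    to \<open>1 + t w \<bullet> a w \<sigma>\<close>, so the normal is divided by this; the rotation
    preserves inner products.\<close>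
  define z where "z = (\<lambda>w. case_sum (\<lambda>v. rot (u w) (p w v + t w))
      (\<lambda>\<sigma>. rot (u w) (a w \<sigma>) /\<^sub>R (1 + t w \<bullet> a w \<sigma>)))"
  \<comment> \<open>Padding with zeros places the image in \<open>Euclidean_space n\<close> also
    when \<open>card C < n\<close>.\<close>
  define \<Phi> where "\<Phi> = (\<lambda>(z :: real^3 + (real^3) set \<Rightarrow> real^3) j. if j < card C then z (fst (c j)) \<bullet> snd (c j) else 0)"
  have XL: "X w \<in> L" for w by (auto simp: X_def L_def edge_length_space_def Edges_T)
  have contX: "continuous_on UNIV X"
  proof (rule continuous_on_coordinatewise_then_product)
    show "continuous_on UNIV (\<lambda>w. X w e)" for e by (cases "e \<in> E") (simp_all add: X_def)
  qed
  have cont\<psi>: "continuous_on UNIV (\<lambda>w. \<psi> (X w))"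
    using XL by (intro continuous_on_compose2[OF \<psi>(1) contX]) auto
  have contp: "continuous_on A (\<lambda>w. p w v)" and conta: "continuous_on A (\<lambda>w. a w \<sigma>)" for v \<sigma> A
    unfolding p_def a_def
    using continuous_on_product_then_coordinatewise[OF continuous_on_fst[OF cont\<psi>], of v]
      continuous_on_product_then_coordinatewise[OF continuous_on_snd[OF cont\<psi>], of \<sigma>]
    by (auto elim: continuous_on_subset)
  have contw: "continuous_on A (\<lambda>w :: nat \<Rightarrow> real. w i)" for i A
    by (rule continuous_on_subset[OF continuous_on_product_coordinates]) simp
  have contu: "continuous_on A u" and contt: "continuous_on A t" for A
  proof -
    have "continuous_on A (\<lambda>w. if i = 1 then w k else if i = 2 then w (k + 1) else w (k + 2))"
      "continuous_on A (\<lambda>w. if i = 1 then w (k + 3) else if i = 2 then w (k + 4) else w (k + 5))"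
      for i :: 3 by (cases "i = 1"; cases "i = 2"; simp add: contw)+
    then show "continuous_on A u" "continuous_on A t"
      unfolding u_def t_def by (intro continuous_on_vec_lambda; simp)+
  qed
  define U1 where "U1 = X -` G \<inter> (\<Inter>\<sigma>\<in>F. {w. 0 < 1 + t w \<bullet> a w \<sigma>})"
  have openU1: "open U1"
    unfolding U1_def
    by (intro open_Int open_INT finite_F ballI open_Collect_less continuous_intros contt conta
        open_vimage[OF G(1) contX])
  have contz: "continuous_on U1 (\<lambda>w. z w m)" if m: "m \<in> V <+> F" for m
  proof (cases m)
    case (Inl v)
    then show ?thesis unfolding z_def by (auto intro!: continuous_intros contu contt contp)
  next
    case (Inr \<sigma>)
    then have "1 + t w \<bullet> a w \<sigma> \<noteq> 0" if "w \<in> U1" for w using that m by (force simp: U1_def)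
    then show ?thesis unfolding z_def Inr by (auto intro!: continuous_intros contu contt conta)
  qed
  \<comment> \<open>\<open>U1\<close> keeps the denominators positive and the edge lengths where
    \<open>\<psi>\<close> realizes them. \<open>U\<close> adds that the coordinates determine
    \<open>z w\<close> and that the vertex differences span.\<close>
  define U where "U = U1 \<inter> (\<Inter>m\<in>V <+> F. U1 \<inter> (\<lambda>w. z w m) -` ball (z0 m) \<epsilon>) \<inter>
      (\<Inter>v\<in>V. {w. dist (p w v - p w v0) (v - v0) < \<delta>})"
  have openU: "open U"
    unfolding U_def
    by (intro open_Int open_INT ballI openU1 finite_V continuous_open_preimage contz open_ball
        open_Collect_less continuous_intros contp)
       (auto simp: finite_V finite_F)
  have eqs: "incidence_eqs (z w)" if "w \<in> U" for w
    unfolding incidence_eqs_def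
  proof (intro ballI impI)
    fix v \<sigma> assume v: "v \<in> V" "\<sigma> \<in> F" "v \<in> \<sigma>"
    have "(p w, a w) \<in> REAL T" using \<psi>(2) XL[of w] by (auto simp: p_def a_def)
    then have "p w v \<bullet> a w \<sigma> = 1" using v by (rule REAL_incident)
    moreover have "0 < 1 + t w \<bullet> a w \<sigma>" using that v by (auto simp: U_def U1_def)
    ultimately show "z w (Inl v) \<bullet> z w (Inr \<sigma>) = 1"
      by (simp add: z_def inner_rot inner_add_left)
  qed
  have determined: "z w m = z' m"
    if "w \<in> U" "incidence_eqs z'" "\<Phi> (z w) = \<Phi> z'" "m \<in> V <+> F" for w z' m
  proof -
    have "\<forall>m\<in>V <+> F. z w m = z' m"
    proof (rule \<epsilon>(2)[unfolded determines_def, THEN spec, THEN spec, THEN mp, THEN mp, THEN mp])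
      show "\<forall>n\<in>V <+> F. dist (z w n) (z0 n) < \<epsilon>"
      proof
        fix m assume "m \<in> V <+> F"
        then have "w \<in> U1 \<inter> (\<lambda>w. z w m) -` ball (z0 m) \<epsilon>" using that(1) unfolding U_def by blast
        then show "dist (z w m) (z0 m) < \<epsilon>" by (simp add: dist_commute)
      qed
      show "\<forall>m\<in>V <+> F. \<forall>n\<in>V <+> F. adjacent m n \<longrightarrow> z w m \<bullet> z w n = 1 \<and> z' m \<bullet> z' n = 1"
        using incidence_eqsD eqs[OF that(1)] that(2) by blast
      show "\<forall>(n, b)\<in>C. z w n \<bullet> b = z' n \<bullet> b"
      proof clarify
        fix n b assume "(n, b) \<in> C"
        then have "(n, b) \<in> c ` {0..<card C}" using bij_betw_imp_surj_on[OF c] by simp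
        then obtain j where "j < card C" "c j = (n, b)" by force
        then show "z w n \<bullet> b = z' n \<bullet> b" using fun_cong[OF that(3), of j] by (simp add: \<Phi>_def)
      qed
    qed
    then show ?thesis using that(4) by blast
  qed
  have dist_z: "dist (z w (Inl i)) (z w (Inl j)) = dist (p w i) (p w j)" for w i j
    by (simp add: z_def dist_rot)
  have lengths: "edge_length_map T (\<psi> (X w)) = X w" if "w \<in> U" for w
  proof -
    have "X w \<in> G" using that by (simp add: U_def U1_def)
    then show ?thesis using W(3) XL[of w] G(2) by simp
  qed
  have edge_V: "i \<in> V \<and> j \<in> V" if "{i, j} \<in> E" for i j
    using E_pair[OF that] by (auto simp: doubleton_eq_iff)
  define f where "f = (\<lambda>w. \<Phi> (z w))"
  have "continuous_map (subtopology (Euclidean_space n) (U \<inter> S)) (Euclidean_space n) f"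
    unfolding cm_Euclidean_space_iff_continuous_on
  proof
    show "continuous_on (topspace (subtopology (Euclidean_space n) (U \<inter> S))) f"
    proof (rule continuous_on_subset)
      show "continuous_on U1 f"
        unfolding f_def
      proof (rule continuous_on_coordinatewise_then_product)
        fix j
        show "continuous_on U1 (\<lambda>w. \<Phi> (z w) j)"
        proof (cases "j < card C")
          case True
          then have "c j \<in> C" using c by (auto simp: bij_betw_def)
          then have "fst (c j) \<in> V <+> F" using C(2) by blast
          then show ?thesis using True by (auto simp: \<Phi>_def intro!: continuous_intros contz)
        qed (simp add: \<Phi>_def)
      qed
    qed (auto simp: U_def)
    show "f \<in> topspace (subtopology (Euclidean_space n) (U \<inter> S)) \<rightarrow> topspace (Euclidean_space n)"
      using C(3) by (auto simp: f_def \<Phi>_def topspace_Euclidean_space n_def k_def)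
  qed
  moreover have "openin (Euclidean_space n) (U \<inter> S)"
    using openU unfolding S_def Euclidean_space_def euclidean_product_topology
    by (auto simp: openin_open)
  moreover have "inj_on f (U \<inter> S)"
  proof (rule inj_onI)
    fix w w' assume w: "w \<in> U \<inter> S" "w' \<in> U \<inter> S" "f w = f w'"
    have zz: "z w m = z w' m" if "m \<in> V <+> F" for m
      using determined[of w "z w'" m] w that eqs by (auto simp: f_def)
    have "edge_length_map T (\<psi> (X w)) = edge_length_map T (\<psi> (X w'))"
    proof (rule edge_length_map_cong)
      fix i j assume "{i, j} \<in> E"
      then have "i \<in> V" "j \<in> V" using edge_V by auto
      then show "dist (fst (\<psi> (X w)) i) (fst (\<psi> (X w)) j) = dist (fst (\<psi> (X w')) i) (fst (\<psi> (X w')) j)"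
        using dist_z[of w i j] dist_z[of w' i j] zz[of "Inl i"] zz[of "Inl j"] by (simp add: p_def)
    qed
    then have XX: "X w = X w'" using lengths w by simp
    have "u w = u w' \<and> t w = t w'"
    proof (rule rigid_motion_unique[where V = V and p = "p w" and ?v0.0 = v0])
      show "rot (u w) (p w v + t w) = rot (u w') (p w v + t w')" if "v \<in> V" for v
        using zz[of "Inl v"] that XX by (simp add: z_def p_def)
      show "d = 0" if "\<And>v. v \<in> V \<Longrightarrow> (p w v - p w v0) \<bullet> d = 0" for d
        by (rule \<delta>(2)[of "\<lambda>v. p w v - p w v0"]) (use w that in \<open>auto simp: U_def\<close>)
    qed (rule v0)
    then have ut: "u w $ i = u w' $ i" "t w $ i = t w' $ i" for i by simp_all
    show "w = w'"
    proof
      fix i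
      consider "i < k" | "i \<ge> n" | "i = k" | "i = k + 1" | "i = k + 2" | "i = k + 3" | "i = k + 4" | "i = k + 5"
        unfolding n_def by linarith
      then show "w i = w' i"
      proof cases
        case 1
        then have "i \<in> idx ` E" using bij_betw_imp_surj_on[OF idx] by simp
        then obtain e where "e \<in> E" "idx e = i" by blast
        then show ?thesis using fun_cong[OF XX, of e] by (simp add: X_def)
      next
        case 2
        then show ?thesis using w by (simp add: S_def topspace_Euclidean_space)
      qed (use ut[of 1] ut[of 2] ut[of 3] in \<open>simp_all add: u_def t_def\<close>)
    qed
  qed
  ultimately have "openin (Euclidean_space n) (f ` (U \<inter> S))"
    by (intro invariance_of_domain_Euclidean_space)
  then obtain G' where G': "open G'" "f ` (U \<inter> S) = G' \<inter> S"
    unfolding S_def Euclidean_space_def euclidean_product_topology by (auto simp: openin_open Int_commute)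
  \<comment> \<open>The parameter of \<open>P\<close> itself: its own edge lengths, and zeros for
    the identity motion.\<close>
  define w0 where "w0 = (\<lambda>i. if i < k then l0 (inv_into E idx i) else 0)"
  have l0: "l0 \<in> L" using W(2) G(2) by simp
  have X0: "X w0 = l0"
  proof
    fix e
    show "X w0 e = l0 e"
    proof (cases "e \<in> E")
      case True
      then have "idx e < k" "inv_into E idx (idx e) = e" using idx by (auto simp: bij_betw_def)
      then show ?thesis using True by (simp add: X_def w0_def)
    next
      case False
      then have "l0 e = undefined"
        using l0 unfolding L_def edge_length_space_def Edges_T by (rule PiE_arb[rotated])
      then show ?thesis using False by (simp add: X_def)
    qed
  qed
  have u0: "u w0 = 0" "t w0 = 0" by (auto simp: u_def t_def w0_def vec_eq_iff)
  have pa0: "p w0 v = v" "a w0 \<sigma> = N \<sigma>" if "v \<in> V" "\<sigma> \<in> F" for v \<sigma>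
    using that by (simp_all add: p_def a_def X0 \<psi>(3) fst_config snd_config)
  obtain \<sigma>0 where \<sigma>0: "\<sigma>0 \<in> F" using facets_at_vertex[OF v0] by blast
  have z0': "z w0 m = z0 m" if "m \<in> V <+> F" for m
    using that pa0 \<sigma>0 v0 u0 by (auto simp: z_def)
  have "w0 \<in> U1" using X0 W(2) G(2) u0 by (auto simp: U1_def)
  then have "w0 \<in> U"
    unfolding U_def using z0' \<epsilon>(1) \<delta>(1) pa0[OF _ \<sigma>0] v0
    by (intro IntI INT_I) simp_all
  moreover have "w0 \<in> S" by (auto simp: S_def topspace_Euclidean_space w0_def n_def)
  ultimately have "f w0 \<in> G'" using G'(2) by blast
  have "f w0 = \<Phi> z0"
  proof
    fix j
    show "f w0 j = \<Phi> z0 j"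
    proof (cases "j < card C")
      case True
      then have "c j \<in> C" using c by (auto simp: bij_betw_def)
      then have "fst (c j) \<in> V <+> F" using C(2) by blast
      then show ?thesis using z0' by (simp add: f_def \<Phi>_def)
    qed (simp add: f_def \<Phi>_def)
  qed
  have "continuous_on UNIV \<Phi>"
  proof (rule continuous_on_coordinatewise_then_product)
    show "continuous_on UNIV (\<lambda>z. \<Phi> z j)" for j
      unfolding \<Phi>_def by (cases "j < card C") (auto intro!: continuous_intros)
  qed
  then have "open (\<Phi> -` G')" using G'(1) open_vimage by blast
  moreover have "z0 \<in> \<Phi> -` G'" using \<open>f w0 \<in> G'\<close> \<open>f w0 = \<Phi> z0\<close> by simp
  ultimately have "\<forall>\<^sub>F z in nhds z0. z \<in> \<Phi> -` G'" by (rule eventually_nhds_in_open)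
  then show ?thesis
  proof (rule eventually_mono, intro impI ballI)
    fix z' i j
    assume z': "z' \<in> \<Phi> -` G'" "incidence_eqs z'"
      "\<forall>i j. {i, j} \<in> E \<longrightarrow> dist (z' (Inl i)) (z' (Inl j)) = dist i j" and ij: "i \<in> V" "j \<in> V"
    have "\<Phi> z' \<in> S" using C(3) by (auto simp: S_def \<Phi>_def topspace_Euclidean_space n_def k_def)
    \<comment> \<open>Openness of the image provides \<open>w\<close> with the coordinates of
      \<open>z'\<close>. As \<open>determined\<close> asks for nearness of \<open>z w\<close> only,
      \<open>z w\<close> and \<open>z'\<close> agree.\<close>
    then obtain w where w: "w \<in> U" "f w = \<Phi> z'" using G'(2) z'(1) by (metis IntD1 IntI imageE vimageE)
    have zz: "dist (p w i) (p w j) = dist (z' (Inl i)) (z' (Inl j))" if "i \<in> V" "j \<in> V" for i j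
      using determined[OF w(1) z'(2), of "Inl i"] determined[OF w(1) z'(2), of "Inl j"] w(2) that
        dist_z[of w i j] by (simp add: f_def)
    have "edge_length_map T (\<psi> (X w)) = edge_length_map T (polytope_config P)"
    proof (rule edge_length_map_cong)
      fix i j assume "{i, j} \<in> E"
      then show "dist (fst (\<psi> (X w)) i) (fst (\<psi> (X w)) j) =
          dist (fst (polytope_config P) i) (fst (polytope_config P) j)"
        using zz[of i j] edge_V[of i j] z'(3) dist_config by (simp add: p_def)
    qed
    then have "X w = l0" using lengths[OF w(1)] by (simp add: l0_def)
    then have "p w v = v" if "v \<in> V" for v using that by (simp add: p_def \<psi>(3) fst_config)
    then show "dist (z' (Inl i)) (z' (Inl j)) = dist i j" using zz[OF ij] ij by simp
  qed
qed

end

section \<open>Motions\<close>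

lemma tendsto_fun:
  fixes f :: "'a \<Rightarrow> 'b \<Rightarrow> 'c::topological_space"
  assumes "\<And>i. ((\<lambda>x. f x i) \<longlongrightarrow> l i) F"
  shows "(f \<longlongrightarrow> l) F"
proof -
  have "limitin (product_topology (\<lambda>_. euclidean) UNIV) f l F"
    using assms by (simp add: limitin_componentwise)
  then show ?thesis by (simp add: euclidean_product_topology)
qed

context polytope3
begin

text \<open>The isometry comes from the vertices alone. That it also carries the rescaled normals to
  \<open>N\<close> follows since both sides pair alike with the vertices of a facet, which span
  space.\<close>

lemma congruent_realization:
  assumes pa: "(p, a) \<in> REAL T" and dist: "\<And>v w. v \<in> V \<Longrightarrow> w \<in> V \<Longrightarrow> dist (p v) (p w) = dist v w"
  obtains A c where "orthogonal_transformation A" "\<And>v. v \<in> V \<Longrightarrow> A (p v - c) = v"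
    "\<And>\<sigma>. \<sigma> \<in> F \<Longrightarrow> 1 - c \<bullet> a \<sigma> \<noteq> 0" "\<And>\<sigma>. \<sigma> \<in> F \<Longrightarrow> A (a \<sigma>) /\<^sub>R (1 - c \<bullet> a \<sigma>) = N \<sigma>"
proof -
  obtain v0 where v0: "v0 \<in> V" using V_nonempty by blast
  obtain B c where B: "orthogonal_transformation B" "\<And>v. v \<in> V \<Longrightarrow> p v = B v + c"
    using congruent_families_isometry[OF v0 span_vertices[OF v0] dist] by blast
  define A where "A = inv_into UNIV B"
  have A: "orthogonal_transformation A" unfolding A_def by (rule orthogonal_transformation_inv[OF B(1)])
  have AB: "A (B x) = x" for x
    unfolding A_def by (rule inv_f_f[OF orthogonal_transformation_inj[OF B(1)]])
  have Ap: "A (p v - c) = v" if "v \<in> V" for v using B(2)[OF that] AB by simp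
  have AA: "A x \<bullet> A y = x \<bullet> y" for x y using A by (simp add: orthogonal_transformation_def)
  have *: "1 - c \<bullet> a \<sigma> \<noteq> 0 \<and> A (a \<sigma>) = (1 - c \<bullet> a \<sigma>) *\<^sub>R N \<sigma>" if \<sigma>: "\<sigma> \<in> F" for \<sigma>
  proof -
    have "A (a \<sigma>) - (1 - c \<bullet> a \<sigma>) *\<^sub>R N \<sigma> = 0"
    proof (rule facet_vertices_span[OF \<sigma>])
      fix v assume v: "v \<in> V \<inter> \<sigma>"
      have "A (a \<sigma>) \<bullet> v = a \<sigma> \<bullet> (p v - c)" using Ap[of v] AA[of "a \<sigma>" "p v - c"] v by simp
      also have "\<dots> = 1 - c \<bullet> a \<sigma>"
        using REAL_incident[OF pa _ \<sigma>, of v] v by (simp add: inner_diff_right inner_commute)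
      finally show "(A (a \<sigma>) - (1 - c \<bullet> a \<sigma>) *\<^sub>R N \<sigma>) \<bullet> v = 0"
        using mem_F[OF \<sigma>, of v] v by (simp add: inner_diff_left)
    qed
    \<comment> \<open>A zero factor would make the normal vanish, against its incidence
      equations.\<close>
    moreover have "1 - c \<bullet> a \<sigma> \<noteq> 0"
    proof
      assume "1 - c \<bullet> a \<sigma> = 0"
      then have "A (a \<sigma>) = 0" using calculation by simp
      then have "a \<sigma> = 0" using AA[of "a \<sigma>" "a \<sigma>"] by simp
      moreover obtain v where "v \<in> V \<inter> \<sigma>" using facet_vertices_nonempty[OF \<sigma>] by blast
      ultimately show False using REAL_incident[OF pa _ \<sigma>, of v] by simp
    qed
    ultimately show ?thesis by simp
  qed
  show ?thesis
    by (rule that[OF A Ap]) (use * in auto)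
qed

lemma rigid:
  assumes real: "edge_length_perturbations_realizable T (polytope_config P)"
  shows "rigid_config T (polytope_config P)"
  unfolding rigid_config_def
proof (intro allI impI)
  fix \<gamma> assume "is_motion T (polytope_config P) \<gamma>"
  then have cont: "continuous_on {0..1} \<gamma>" and REAL: "\<And>t. t \<in> {0..1} \<Longrightarrow> \<gamma> t \<in> REAL T"
    and start: "\<gamma> 0 = polytope_config P"
    and equiv: "\<And>t. t \<in> {0..1} \<Longrightarrow> equivalent T (\<gamma> t) (polytope_config P)"
    by (auto simp: is_motion_def)
  define p where "p = (\<lambda>t. fst (\<gamma> t))"
  define a where "a = (\<lambda>t. snd (\<gamma> t))"
  have pa: "(p t, a t) \<in> REAL T" if "t \<in> {0..1}" for t using REAL[OF that] by (simp add: p_def a_def)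
  have edges: "dist (p t i) (p t j) = dist i j" if "t \<in> {0..1}" "{i, j} \<in> E" for t i j
    using equiv[OF that(1)] that(2) dist_config[OF that(2)]
    by (simp add: equivalent_def Edges_T p_def dist_norm)
  have contp: "continuous_on {0..1} (\<lambda>t. p t v)" and conta: "continuous_on {0..1} (\<lambda>t. a t \<sigma>)" for v \<sigma>
    unfolding p_def a_def
    by (rule continuous_on_product_then_coordinatewise[OF continuous_on_fst[OF cont]],
        rule continuous_on_product_then_coordinatewise[OF continuous_on_snd[OF cont]])
  define K where "K = {t\<in>{0..1}. \<forall>i\<in>V. \<forall>j\<in>V. dist (p t i) (p t j) = dist i j}"
  have "K = {0..1} \<inter> (\<Inter>i\<in>V. \<Inter>j\<in>V. {t\<in>{0..1}. dist (p t i) (p t j) = dist i j})"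
    by (auto simp: K_def)
  also have "closed \<dots>"
    by (intro closed_Int closed_INT ballI continuous_closed_preimage_constant continuous_on_dist contp) auto
  finally have "closedin (top_of_set {0..1}) K" by (rule closed_subset[rotated]) (auto simp: K_def)
  moreover have "openin (top_of_set {0..1}) K"
    unfolding openin_subopen[of _ K]
  proof
    fix s assume "s \<in> K"
    then have s: "s \<in> {0..1}" and congr: "\<And>i j. i \<in> V \<Longrightarrow> j \<in> V \<Longrightarrow> dist (p s i) (p s j) = dist i j"
      by (auto simp: K_def)
    obtain A c where A: "orthogonal_transformation A" "\<And>v. v \<in> V \<Longrightarrow> A (p s v - c) = v"
      "\<And>\<sigma>. \<sigma> \<in> F \<Longrightarrow> 1 - c \<bullet> a s \<sigma> \<noteq> 0" "\<And>\<sigma>. \<sigma> \<in> F \<Longrightarrow> A (a s \<sigma>) /\<^sub>R (1 - c \<bullet> a s \<sigma>) = N \<sigma>"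
      using congruent_realization[OF pa[OF s] congr] by blast
    have bl: "bounded_linear A"
      using A(1) by (simp add: orthogonal_transformation_def linear_conv_bounded_linear)
    have AA: "A x \<bullet> A y = x \<bullet> y" for x y using A(1) by (simp add: orthogonal_transformation_def)
    have Adist: "dist (A (x - c)) (A (y - c)) = dist x y" for x y
      using A(1) unfolding orthogonal_transformation_isometry by (simp add: dist_norm)
    \<comment> \<open>The motion after moving its position at time \<open>s\<close> back to
      \<open>P\<close>. The values outside \<open>V\<close> and \<open>F\<close> are those of
      \<open>z0\<close>, because convergence in the function space concerns every index.\<close>
    define g where "g = (\<lambda>t. case_sum (\<lambda>v. if v \<in> V then A (p t v - c) else v)
        (\<lambda>\<sigma>. if \<sigma> \<in> F then A (a t \<sigma>) /\<^sub>R (1 - c \<bullet> a t \<sigma>) else N \<sigma>))"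
    have tp: "((\<lambda>t. p t v) \<longlongrightarrow> p s v) (at s within {0..1})" for v
      using contp s by (auto simp: continuous_on_def)
    have ta: "((\<lambda>t. a t \<sigma>) \<longlongrightarrow> a s \<sigma>) (at s within {0..1})" for \<sigma>
      using conta s by (auto simp: continuous_on_def)
    have "(g \<longlongrightarrow> z0) (at s within {0..1})"
    proof (rule tendsto_fun)
      fix m
      show "((\<lambda>t. g t m) \<longlongrightarrow> z0 m) (at s within {0..1})"
      proof (cases m)
        case (Inl v)
        have "((\<lambda>t. A (p t v - c)) \<longlongrightarrow> A (p s v - c)) (at s within {0..1})"
          by (intro bounded_linear.tendsto[OF bl] tendsto_diff tp tendsto_const)
        then show ?thesis using A(2)[of v] Inl by (cases "v \<in> V") (simp_all add: g_def)
      next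
        case (Inr \<sigma>)
        have "((\<lambda>t. A (a t \<sigma>) /\<^sub>R (1 - c \<bullet> a t \<sigma>)) \<longlongrightarrow> A (a s \<sigma>) /\<^sub>R (1 - c \<bullet> a s \<sigma>)) (at s within {0..1})"
          if "\<sigma> \<in> F"
          by (intro bounded_linear.tendsto[OF bl] tendsto_intros ta A(3)[OF that])
        then show ?thesis using A(4)[of \<sigma>] Inr by (cases "\<sigma> \<in> F") (simp_all add: g_def)
      qed
    qed
    with local_rigidity[OF real]
    have "\<forall>\<^sub>F t in at s within {0..1}. incidence_eqs (g t) \<longrightarrow>
        (\<forall>i j. {i, j} \<in> E \<longrightarrow> dist (g t (Inl i)) (g t (Inl j)) = dist i j) \<longrightarrow>
        (\<forall>i\<in>V. \<forall>j\<in>V. dist (g t (Inl i)) (g t (Inl j)) = dist i j)"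
      by (rule eventually_compose_filterlim)
    moreover have "\<forall>\<^sub>F t in at s within {0..1}. \<forall>\<sigma>\<in>F. 1 - c \<bullet> a t \<sigma> \<noteq> 0"
    proof (rule eventually_ball_finite[OF finite_F], rule ballI)
      fix \<sigma> assume "\<sigma> \<in> F"
      then show "\<forall>\<^sub>F t in at s within {0..1}. 1 - c \<bullet> a t \<sigma> \<noteq> 0"
        by (intro tendsto_imp_eventually_ne[OF _ A(3)]) (auto intro!: tendsto_intros ta)
    qed
    moreover have "\<forall>\<^sub>F t in at s within {0..1}. t \<in> {0..1}" by (auto simp: eventually_at_filter)
    ultimately have "\<forall>\<^sub>F t in at s within {0..1}. t \<in> K"
    proof eventually_elim
      case (elim t)
      have dg: "dist (g t (Inl i)) (g t (Inl j)) = dist (p t i) (p t j)" if "i \<in> V" "j \<in> V" for i j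
        using that by (simp add: g_def Adist)
      have "incidence_eqs (g t)"
        unfolding incidence_eqs_def
      proof (intro ballI impI)
        fix v \<sigma> assume v: "v \<in> V" "\<sigma> \<in> F" "v \<in> \<sigma>"
        have "p t v \<bullet> a t \<sigma> = 1" by (rule REAL_incident[OF pa v]) (rule elim)
        then show "g t (Inl v) \<bullet> g t (Inr \<sigma>) = 1"
          using v elim(2) by (simp add: g_def AA inner_diff_left)
      qed
      moreover have "dist (g t (Inl i)) (g t (Inl j)) = dist i j" if ij: "{i, j} \<in> E" for i j
      proof -
        have "i \<in> V" "j \<in> V" using E_pair[OF ij] by (auto simp: doubleton_eq_iff)
        then show ?thesis using dg edges[OF elim(3) ij] by simp
      qed
      ultimately have "\<forall>i\<in>V. \<forall>j\<in>V. dist (g t (Inl i)) (g t (Inl j)) = dist i j"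
        using elim(1) by blast
      then show "t \<in> K" using dg elim(3) by (simp add: K_def)
    qed
    then obtain O' where "open O'" "s \<in> O'" "\<And>t. t \<in> O' \<Longrightarrow> t \<noteq> s \<Longrightarrow> t \<in> {0..1} \<Longrightarrow> t \<in> K"
      unfolding eventually_at_topological by blast
    \<comment> \<open>The filter at \<open>s\<close> says nothing about \<open>s\<close> itself,
      which is in \<open>K\<close> already.\<close>
    then have "{0..1} \<inter> O' \<subseteq> K" using \<open>s \<in> K\<close> by (metis IntE subsetI)
    then show "\<exists>O'. openin (top_of_set {0..1}) O' \<and> s \<in> O' \<and> O' \<subseteq> K"
      using s \<open>open O'\<close> \<open>s \<in> O'\<close> by (intro exI[of _ "{0..1} \<inter> O'"]) (simp add: openin_open_Int)
  qed
  moreover have "0 \<in> K" by (simp add: K_def p_def start fst_config)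
  moreover have "connected {0..1::real}" by simp
  ultimately have "K = {0..1}" unfolding connected_clopen by blast
  then have "dist (p t i) (p t j) = dist i j" if "t \<in> {0..1}" "i \<in> V" "j \<in> V" for t i j
  proof -
    have "t \<in> K" using \<open>K = {0..1}\<close> that(1) by (rule ssubst)
    then show ?thesis using that by (simp add: K_def)
  qed
  then show "trivial_motion T (polytope_config P) \<gamma>"
    by (simp add: trivial_motion_def congruent_config_def Verts_T fst_config p_def dist_norm)
qed

end

theorem theorem5p6:
  fixes P :: "(real^3) set"
  assumes "polytope P"
    and "aff_dim P = 3"
    and "0 \<in> interior P"
    and "edge_length_perturbations_realizable (polytope_type P) (polytope_config P)"
  shows "rigid_config (polytope_type P) (polytope_config P)"
proof -
  interpret polytope3 P using assms(1-3) by unfold_locales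
  show ?thesis using assms(4) by (rule rigid)
qed

end
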